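(* Let $(H,(\mathcal{D}_i)_{i=1}^n)$ be a known i.d. input, where $H=(U,B,F)$ is a type graph with downward-closed probing constraints $(\mathcal{C}_b)_{b\in B}$, and assume $r_i(b):=\mathbb{P}[v_i=b]>0$ for all $i\in[n]$, $b\in B$. Let $\pi:[n]\to[n]$ be any permutation chosen by an oblivious adversary (i.e. $\pi$ depends only on $H$ and $(\mathcal{D}_i)_{i=1}^n$). If $\mathcal{M}(\pi)$ is the matching returned by the algorithm AOM-ID described below when the online vertices of $G\sim(H,(\mathcal{D}_i)_{i=1}^n)$ are presented in the order $v_{\pi(1)},\dots,v_{\pi(n)}$, then $$\mathbb{E}[w(\mathcal{M}(\pi))]\ \ge\ \tfrac12\,\mathrm{OPT}(H,(\mathcal{D}_i)_{i=1}^n).$$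
   Context: Stochastic graphs. A stochastic graph is a finite bipartite graph $G=(U,V,E)$ with $E=U\times V$, nonnegative edge weights $(w_e)_{e\in E}$ and edge probabilities $(p_e)_{e\in E}\subseteq[0,1]$. Each edge $e$ has a hidden random state $\mathrm{st}(e)\sim\mathrm{Ber}(p_e)$, independent across edges; $e$ is active if $\mathrm{st}(e)=1$. For a finite set $S$, $S^{( * )}$ is the set of tuples (strings) of pairwise distinct elements of $S$, including the empty string $\lambda$. $\partial(v)$ is the set of edges incident to $v$. Each $v\in V$ has a probing constraint $\mathcal{C}_v\subseteq\partial(v)^{( * )}$, assumed downward-closed: if $\bm e\in\mathcal{C}_v$ then every substring and every permutation of $\bm e$ is in $\mathcal{C}_v$. For a set of edges $M$, $w(M)=\sum_{e\in M}w_e$. Probe-commit model. Probing an edge reveals its state. If a probed edge is active, the algorithm must irrevocably decide whether to add it to its matching before probing any other edge; only probed active edges may be added and the output must be a matching. An offline probing algorithm knows $G$ (not the states) and adaptively (possibly randomly) probes edges in any order such that for every $v\in V$ the sequence of probed edges of $\partial(v)$, in probe order, lies in $\mathcal{C}_v$. $\mathrm{OPT}(G)$ is the supremum over offline probing algorithms of the expected weight of the returned matching. Known i.d. input. A type graph is a stochastic graph $H=(U,B,F)$ with weights $w_{u,b}$, probabilities $p_{u,b}$ and downward-closed constraints $(\mathcal{C}_b)_{b\in B}$. Given $n\ge1$ and distributions $\mathcal{D}_1,\dots,\mathcal{D}_n$ on $B$, the instantiated graph $G=(U,V,E)$, $V=\{v_1,\dots,v_n\}$, is drawn by independently choosing the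 type of $v_i$ from $\mathcal{D}_i$ (written $v_i=b$); $v_i$ is a copy of its type $b$: edge $(u,v_i)$ has weight $w_{u,b}$, probability $p_{u,b}$, and $v_i$ has constraint (the copy of) $\mathcal{C}_b$; edge states are independent. $\mathrm{OPT}(H,(\mathcal{D}_i)_{i=1}^n):=\mathbb{E}[\mathrm{OPT}(G)]$. Online: the algorithm knows $H,n,(\mathcal{D}_i)$ but not $\pi$; at step $t$ the vertex $v_{\pi(t)}$ is revealed together with the index $\pi(t)$ and its type (but not edge states); the algorithm probes edges of $\partial(v_{\pi(t)})$ only, respecting $\mathcal{C}_{v_{\pi(t)}}$ and commitment, before the next arrival. LP. For $\bm e=(e_1,\dots,e_k)$ let $g(\bm e)=\prod_{j=1}^k(1-p_{e_j})$, $g(\lambda)=1$, $\bm e_{<e_j}=(e_1,\dots,e_{j-1})$, and $\mathrm{val}(\bm e)=\sum_{j=1}^k p_{e_j}w_{e_j}g(\bm e_{<e_j})$. LP-config-id has variables $x_i(\bm e\,\|\,b)\ge0$ for $i\in[n]$, $b\in B$, $\bm e\in\mathcal{C}_b$: maximize $\sum_{i,b,\bm e\in\mathcal{C}_b}\mathrm{val}(\bm e)x_i(\bm e\|b)$ subject to $\sum_{i\in[n],b\in B}\sum_{\bm e\in\mathcal{C}_b:(u,b)\in\bm e}p_{u,b}\,g(\bm e_{<(u,b)})\,x_i(\bm e\|b)\le1$ for all $u\in U$, and $\sum_{\bm e\in\mathcal{C}_b}x_i(\bm e\|b)=r_i(b)$ for all $b\in B,i\in[n]$. Given a solution, $\widetilde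 x_{u,i}(b):=\sum_{\bm e\in\mathcal{C}_b:(u,b)\in\bm e}g(\bm e_{<(u,b)})x_i(\bm e\|b)$ and $z_{u,i}:=\sum_{b\in B}p_{u,b}\widetilde x_{u,i}(b)$. VertexProbe on $v_i$ of type $a$: draw $\bm e'\in\mathcal{C}_a$ with probability $x_i(\bm e'\|a)/r_i(a)$ (independent of everything else), probe the edges of $\bm e'$ in order until one is active, and output that edge (output nothing if none is active or $\bm e'=\lambda$). Algorithm AOM-ID: compute an optimal solution of LP-config-id; set $\mathcal{M}=\emptyset$. For $t=1,\dots,n$: let $q_{u,t}=1/(2-\sum_{i=1}^{t-1}z_{u,\pi(i)})$ for $u\in U$; run VertexProbe on $v_{\pi(t)}$; if it outputs $(u,v_{\pi(t)})$ and $u$ is unmatched in $\mathcal{M}$, add this edge to $\mathcal{M}$ independently with probability $q_{u,t}$. Return $\mathcal{M}$. *)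

theory Defs
  imports "HOL-Probability.Probability" "HOL-Library.Sublist"
begin

subsection \<open>Stochastic graphs\<close>

record ('u, 'v) sgraph =
  offline :: "'u set"
  online :: "'v set"
  wt :: "'u \<times> 'v \<Rightarrow> real"
  pr :: "'u \<times> 'v \<Rightarrow> real"
  constr :: "'v \<Rightarrow> ('u \<times> 'v) list set"

definition edges :: "('u, 'v) sgraph \<Rightarrow> ('u \<times> 'v) set" where
  "edges G = offline G \<times> online G"

definition incident :: "('u, 'v) sgraph \<Rightarrow> 'v \<Rightarrow> ('u \<times> 'v) set" where
  "incident G v = {e \<in> edges G. snd e = v}"

definition strings :: "'a set \<Rightarrow> 'a list set" where
  "strings S = {xs. distinct xs \<and> set xs \<subseteq> S}"

definition downward_closed :: "'a list set \<Rightarrow> bool" where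
  "downward_closed C \<longleftrightarrow>
     (\<forall>es\<in>C. (\<forall>fs. sublist fs es \<longrightarrow> fs \<in> C) \<and> (\<forall>fs. mset fs = mset es \<longrightarrow> fs \<in> C))"

definition stochastic_graph :: "('u, 'v) sgraph \<Rightarrow> bool" where
  "stochastic_graph G \<longleftrightarrow>
     finite (offline G) \<and> finite (online G) \<and>
     (\<forall>e\<in>edges G. wt G e \<ge> 0) \<and>
     (\<forall>e\<in>edges G. 0 \<le> pr G e \<and> pr G e \<le> 1) \<and>
     (\<forall>v\<in>online G. constr G v \<subseteq> strings (incident G v) \<and> downward_closed (constr G v))"

definition is_matching :: "('u \<times> 'v) set \<Rightarrow> bool" where
  "is_matching M \<longleftrightarrow> (\<forall>e\<in>M. \<forall>f\<in>M. e \<noteq> f \<longrightarrow> fst e \<noteq> fst f \<and> snd e \<noteq> snd f)"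

definition weight :: "('u, 'v) sgraph \<Rightarrow> ('u \<times> 'v) set \<Rightarrow> real" where
  "weight G M = (\<Sum>e\<in>M. wt G e)"

definition edge_states :: "('u, 'v) sgraph \<Rightarrow> ('u \<times> 'v \<Rightarrow> bool) pmf" where
  "edge_states G = Pi_pmf (edges G) False (\<lambda>e. bernoulli_pmf (pr G e))"


subsection \<open>Offline probing algorithms and the offline optimum\<close>

text \<open>
  An adaptive, randomised probing algorithm is a randomised decision tree.
  \<open>Randomise D\<close> draws the continuation from \<open>D\<close>.  \<open>Probe e T c A R\<close> probes \<open>e\<close> and, if \<open>e\<close> is
  inactive, continues with \<open>T\<close>; if \<open>e\<close> is active, it first decides according to \<open>c\<close> whether to
  add \<open>e\<close> to the matching, and then continues with \<open>A\<close> (added) or \<open>R\<close> (rejected).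
\<close>

datatype 'e probing_tree =
    Halt
  | Randomise "'e probing_tree pmf"
  | Probe 'e "'e probing_tree" "bool pmf" "'e probing_tree" "'e probing_tree"

text \<open>
  The outcome of a run for a given realisation of the edge states: the list of probed edges in
  probe order, and the set of edges added.
\<close>

primrec run :: "('e \<Rightarrow> bool) \<Rightarrow> 'e probing_tree \<Rightarrow> ('e list \<times> 'e set) pmf" where
  "run st Halt = return_pmf ([], {})"
| "run st (Randomise D) = join_pmf (map_pmf (run st) D)"
| "run st (Probe e T c A R) =
     (if st e
      then bind_pmf c (\<lambda>add.
             if add then map_pmf (\<lambda>(es, M). (e # es, insert e M)) (run st A)
             else map_pmf (\<lambda>(es, M). (e # es, M)) (run st R))
      else map_pmf (\<lambda>(es, M). (e # es, M)) (run st T))"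

definition offline_probing_algorithm ::
    "('u, 'v) sgraph \<Rightarrow> ('u \<times> 'v) probing_tree \<Rightarrow> bool" where
  "offline_probing_algorithm G T \<longleftrightarrow>
     (\<forall>st. \<forall>(es, M) \<in> set_pmf (run st T).
        set es \<subseteq> edges G \<and>
        (\<forall>v\<in>online G. filter (\<lambda>e. snd e = v) es \<in> constr G v) \<and>
        is_matching M)"

definition expected_weight :: "('u, 'v) sgraph \<Rightarrow> ('u \<times> 'v) probing_tree \<Rightarrow> real" where
  "expected_weight G T =
     measure_pmf.expectation (bind_pmf (edge_states G) (\<lambda>st. run st T)) (\<lambda>(es, M). weight G M)"

definition OPT :: "('u, 'v) sgraph \<Rightarrow> real" where
  "OPT G = (SUP T \<in> {T. offline_probing_algorithm G T}. expected_weight G T)"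


subsection \<open>Known i.d. inputs\<close>

text \<open>The online vertex \<open>v\<^sub>i\<close> is represented by its index \<open>i \<in> {1..n}\<close>, and \<open>\<tau> i\<close> is its type.\<close>

definition copy_string :: "nat \<Rightarrow> ('u \<times> 'b) list \<Rightarrow> ('u \<times> nat) list" where
  "copy_string i es = map (\<lambda>e. (fst e, i)) es"

definition inst_graph :: "('u, 'b) sgraph \<Rightarrow> nat \<Rightarrow> (nat \<Rightarrow> 'b) \<Rightarrow> ('u, nat) sgraph" where
  "inst_graph H n \<tau> =
     \<lparr>offline = offline H,
      online = {1..n},
      wt = (\<lambda>(u, i). wt H (u, \<tau> i)),
      pr = (\<lambda>(u, i). pr H (u, \<tau> i)),
      constr = (\<lambda>i. copy_string i ` constr H (\<tau> i))\<rparr>"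

definition type_profile :: "nat \<Rightarrow> (nat \<Rightarrow> 'b pmf) \<Rightarrow> (nat \<Rightarrow> 'b) pmf" where
  "type_profile n D = Pi_pmf {1..n} undefined D"

definition OPT_id :: "('u, 'b) sgraph \<Rightarrow> nat \<Rightarrow> (nat \<Rightarrow> 'b pmf) \<Rightarrow> real" where
  "OPT_id H n D = measure_pmf.expectation (type_profile n D) (\<lambda>\<tau>. OPT (inst_graph H n \<tau>))"


subsection \<open>The configuration LP\<close>

definition none_active :: "('u, 'v) sgraph \<Rightarrow> ('u \<times> 'v) list \<Rightarrow> real" where
  "none_active G es = (\<Prod>e\<leftarrow>es. 1 - pr G e)"

definition before :: "'a list \<Rightarrow> 'a \<Rightarrow> 'a list" where
  "before es e = takeWhile (\<lambda>f. f \<noteq> e) es"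

definition string_val :: "('u, 'v) sgraph \<Rightarrow> ('u \<times> 'v) list \<Rightarrow> real" where
  "string_val G es = (\<Sum>e\<leftarrow>es. pr G e * wt G e * none_active G (before es e))"

text \<open>The LP variable \<open>x\<^sub>i(es \<parallel> b)\<close> is written \<open>x i es b\<close>.\<close>

type_synonym ('u, 'b) lp_vars = "nat \<Rightarrow> ('u \<times> 'b) list \<Rightarrow> 'b \<Rightarrow> real"

definition lp_config_id_feasible ::
    "('u, 'b) sgraph \<Rightarrow> nat \<Rightarrow> (nat \<Rightarrow> 'b pmf) \<Rightarrow> ('u, 'b) lp_vars \<Rightarrow> bool" where
  "lp_config_id_feasible H n D x \<longleftrightarrow>
     (\<forall>i\<in>{1..n}. \<forall>b\<in>online H. \<forall>es\<in>constr H b. x i es b \<ge> 0) \<and>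
     (\<forall>u\<in>offline H.
        (\<Sum>i\<in>{1..n}. \<Sum>b\<in>online H. \<Sum>es\<in>{es \<in> constr H b. (u, b) \<in> set es}.
           pr H (u, b) * none_active H (before es (u, b)) * x i es b) \<le> 1) \<and>
     (\<forall>b\<in>online H. \<forall>i\<in>{1..n}. (\<Sum>es\<in>constr H b. x i es b) = pmf (D i) b)"

definition lp_config_id_value ::
    "('u, 'b) sgraph \<Rightarrow> nat \<Rightarrow> ('u, 'b) lp_vars \<Rightarrow> real" where
  "lp_config_id_value H n x =
     (\<Sum>i\<in>{1..n}. \<Sum>b\<in>online H. \<Sum>es\<in>constr H b. string_val H es * x i es b)"

definition lp_config_id_optimal ::
    "('u, 'b) sgraph \<Rightarrow> nat \<Rightarrow> (nat \<Rightarrow> 'b pmf) \<Rightarrow> ('u, 'b) lp_vars \<Rightarrow> bool" where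
  "lp_config_id_optimal H n D x \<longleftrightarrow>
     lp_config_id_feasible H n D x \<and>
     (\<forall>y. lp_config_id_feasible H n D y \<longrightarrow> lp_config_id_value H n y \<le> lp_config_id_value H n x)"

definition x_tilde :: "('u, 'b) sgraph \<Rightarrow> ('u, 'b) lp_vars \<Rightarrow> 'u \<Rightarrow> nat \<Rightarrow> 'b \<Rightarrow> real" where
  "x_tilde H x u i b =
     (\<Sum>es\<in>{es \<in> constr H b. (u, b) \<in> set es}. none_active H (before es (u, b)) * x i es b)"

definition z_marg :: "('u, 'b) sgraph \<Rightarrow> ('u, 'b) lp_vars \<Rightarrow> 'u \<Rightarrow> nat \<Rightarrow> real" where
  "z_marg H x u i = (\<Sum>b\<in>online H. pr H (u, b) * x_tilde H x u i b)"


subsection \<open>The online algorithm\<close>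

text \<open>
  For a feasible \<open>x\<close> and \<open>pmf (D i) a > 0\<close> the function below is a probability mass function, as
  \<open>embed_pmf\<close> requires.
\<close>

definition draw_string ::
    "('u, 'b) sgraph \<Rightarrow> (nat \<Rightarrow> 'b pmf) \<Rightarrow> ('u, 'b) lp_vars \<Rightarrow> nat \<Rightarrow> 'b \<Rightarrow> ('u \<times> 'b) list pmf" where
  "draw_string H D x i a =
     embed_pmf (\<lambda>es. if es \<in> constr H a then x i es a / pmf (D i) a else 0)"

text \<open>The \<open>find\<close> below returns the first active edge of the string, if there is one.\<close>

definition vertex_probe ::
    "('u, 'b) sgraph \<Rightarrow> (nat \<Rightarrow> 'b pmf) \<Rightarrow> ('u, 'b) lp_vars \<Rightarrow> ('u \<times> nat \<Rightarrow> bool) \<Rightarrow> nat \<Rightarrow> 'b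
      \<Rightarrow> ('u \<times> nat) option pmf" where
  "vertex_probe H D x st i a = map_pmf (\<lambda>es. find st (copy_string i es)) (draw_string H D x i a)"

definition accept_prob ::
    "('u, 'b) sgraph \<Rightarrow> ('u, 'b) lp_vars \<Rightarrow> (nat \<Rightarrow> nat) \<Rightarrow> 'u \<Rightarrow> nat \<Rightarrow> real" where
  "accept_prob H x \<pi> u t = 1 / (2 - (\<Sum>i\<in>{1..<t}. z_marg H x u (\<pi> i)))"

text \<open>The matching after the first \<open>t\<close> arrivals, for fixed types \<open>\<tau>\<close> and edge states \<open>st\<close>.\<close>

primrec aom_id_steps ::
    "('u, 'b) sgraph \<Rightarrow> (nat \<Rightarrow> 'b pmf) \<Rightarrow> ('u, 'b) lp_vars \<Rightarrow> (nat \<Rightarrow> nat) \<Rightarrow>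
     (nat \<Rightarrow> 'b) \<Rightarrow> ('u \<times> nat \<Rightarrow> bool) \<Rightarrow> nat \<Rightarrow> ('u \<times> nat) set pmf" where
  "aom_id_steps H D x \<pi> \<tau> st 0 = return_pmf {}"
| "aom_id_steps H D x \<pi> \<tau> st (Suc t) =
     bind_pmf (aom_id_steps H D x \<pi> \<tau> st t) (\<lambda>M.
     bind_pmf (vertex_probe H D x st (\<pi> (Suc t)) (\<tau> (\<pi> (Suc t)))) (\<lambda>out.
       case out of
         None \<Rightarrow> return_pmf M
       | Some e \<Rightarrow>
           if fst e \<in> fst ` M then return_pmf M
           else map_pmf (\<lambda>add. if add then insert e M else M)
                  (bernoulli_pmf (accept_prob H x \<pi> (fst e) (Suc t)))))"

text \<open>
  The joint distribution of the type profile and the returned matching, when the algorithm uses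
  the LP solution \<open>x\<close> and the vertices arrive in the order \<open>\<pi> 1, \<dots>, \<pi> n\<close>.
\<close>

definition aom_id ::
    "('u, 'b) sgraph \<Rightarrow> nat \<Rightarrow> (nat \<Rightarrow> 'b pmf) \<Rightarrow> ('u, 'b) lp_vars \<Rightarrow> (nat \<Rightarrow> nat)
      \<Rightarrow> ((nat \<Rightarrow> 'b) \<times> ('u \<times> nat) set) pmf" where
  "aom_id H n D x \<pi> =
     bind_pmf (type_profile n D) (\<lambda>\<tau>.
     bind_pmf (edge_states (inst_graph H n \<tau>)) (\<lambda>st.
       map_pmf (\<lambda>M. (\<tau>, M)) (aom_id_steps H D x \<pi> \<tau> st n)))"

end

theory Submission
  imports Defs
begin

text \<open>
  The optimal value of the configuration LP is an upper bound on the offline optimum, and the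
  online algorithm earns exactly half of it.

  Upper bound: fix an online vertex \<open>v\<close> and a probing tree. Once an edge at \<open>v\<close> is added, no later
  probe at \<open>v\<close> can be used, and an active edge that is rejected need not have been probed as far
  as \<open>v\<close> is concerned. An induction on the tree therefore replaces its behaviour at \<open>v\<close> by a
  random string of \<open>\<C>\<^sub>v\<close>, probed until the first active edge, without changing the probability
  that any given edge at \<open>v\<close> is added. Averaging these strings over the random types gives a
  feasible LP solution whose value is the expected weight of the tree.

  Algorithm: let \<open>s\<close> be the sum of \<open>z\<^sub>u\<^sub>,\<^sub>\<pi>\<^sub>(\<^sub>j\<^sub>)\<close> over the vertices that have already arrived. By
  induction \<open>u\<close> is free with probability \<open>1 - s / 2\<close>, independently of the type and the edges of
  the arriving vertex, and accepting with probability \<open>1 / (2 - s)\<close> makes every potential match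
  \<open>(u, v)\<close> happen with exactly half of its LP probability.
\<close>

section \<open>Expectations over product distributions\<close>

text \<open>Why one half: to match every pair at a fraction \<open>c\<close> of its LP rate, an
  arrival after load \<open>s\<close> has to be accepted with probability
  \<open>c / (1 - c * s)\<close>. The capacity constraint gives \<open>s \<le> 1\<close>, and for
  \<open>0 < c < 1\<close> this number stays at most 1 for all such \<open>s\<close> exactly when
  \<open>c \<le> 1 / 2\<close>.

  Only marginals have to survive the passage from trees to strings. A tree may coordinate its
  decisions across vertices, but the LP objective and the capacity constraints are linear in the
  probabilities that single edges are added. Each vertex can therefore get a string law of its own,
  and the laws need no coupling.

  Two obstacles shape the argument. A subtree is reached for only one value of the state of the edge
  probed above it, while validity is stated for all states; that no edge is probed twice closes this
  gap, and it also makes the subtree independent of that state. Further, the supremum in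
  \<open>OPT\<close> is not shown to be attained, so nearly optimal trees are chosen, one for each
  type profile, and the error is sent to 0.\<close>

lemma expectation_bind_pmf:
  fixes h :: "'b \<Rightarrow> real"
  assumes bnd: "\<And>x y. x \<in> set_pmf p \<Longrightarrow> y \<in> set_pmf (f x) \<Longrightarrow> \<bar>h y\<bar> \<le> C"
  shows "measure_pmf.expectation (bind_pmf p f) h =
    measure_pmf.expectation p (\<lambda>x. measure_pmf.expectation (f x) h)"
proof -
  \<comment> \<open>The library rule \<open>integral_bind\<close> asks for a bound everywhere, while
    \<open>h\<close> is bounded only on the support; \<open>h'\<close> cuts it off outside.\<close>
  define h' where "h' y = (if y \<in> set_pmf (bind_pmf p f) then h y else 0)" for y
  have "0 \<le> C"
    by (meson abs_ge_zero bnd order_trans set_pmf_not_empty ex_in_conv)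
  then have bnd': "\<bar>h' y\<bar> \<le> C" for y
    using bnd by (auto simp: h'_def)
  have "measure_pmf.expectation (bind_pmf p f) h = measure_pmf.expectation (bind_pmf p f) h'"
    by (intro integral_cong_AE) (auto simp: AE_measure_pmf_iff h'_def)
  also have "\<dots> = measure_pmf.expectation p (\<lambda>x. measure_pmf.expectation (f x) h')"
    unfolding measure_pmf_bind
    by (rule integral_bind[where K = "count_space UNIV" and B = C and B' = 1])
       (auto simp: bnd' measure_pmf.emeasure_space_1 measure_pmf_in_subprob_space)
  also have "\<dots> = measure_pmf.expectation p (\<lambda>x. measure_pmf.expectation (f x) h)"
    by (intro integral_cong_AE) (auto simp: AE_measure_pmf_iff h'_def intro!: integral_cong_AE)
  finally show ?thesis .
qed

lemma expectation_bind_pmf_finite: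
  fixes h :: "'b \<Rightarrow> real"
  assumes "finite (set_pmf (bind_pmf p f))"
  shows "measure_pmf.expectation (bind_pmf p f) h =
    measure_pmf.expectation p (\<lambda>x. measure_pmf.expectation (f x) h)"
proof (rule expectation_bind_pmf)
  fix x y assume "x \<in> set_pmf p" "y \<in> set_pmf (f x)"
  then show "\<bar>h y\<bar> \<le> (\<Sum>y\<in>set_pmf (bind_pmf p f). \<bar>h y\<bar>)"
    using member_le_sum[of y "set_pmf (bind_pmf p f)" "\<lambda>y. \<bar>h y\<bar>"] assms by auto
qed

text \<open>Fubini: both sides are the expectation under the law of the independent pair, and
  independent draws commute.\<close>

lemma expectation_swap_pmf:
  fixes h :: "'a \<Rightarrow> 'b \<Rightarrow> real"
  assumes bnd: "\<And>x y. x \<in> set_pmf p \<Longrightarrow> y \<in> set_pmf q \<Longrightarrow> \<bar>h x y\<bar> \<le> C"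
  shows "measure_pmf.expectation p (\<lambda>x. measure_pmf.expectation q (\<lambda>y. h x y)) =
    measure_pmf.expectation q (\<lambda>y. measure_pmf.expectation p (\<lambda>x. h x y))"
proof -
  have "measure_pmf.expectation (bind_pmf p (\<lambda>x. map_pmf (\<lambda>y. (x, y)) q)) (case_prod h) =
    measure_pmf.expectation (bind_pmf q (\<lambda>y. map_pmf (\<lambda>x. (x, y)) p)) (case_prod h)"
    unfolding map_pmf_def by (subst bind_commute_pmf) simp
  then show ?thesis
    using bnd by (subst (asm) (1 2) expectation_bind_pmf[where C = C]) auto
qed

text \<open>Plays the part of measurability with respect to the coordinates in \<open>J\<close>;
  independence then reduces to disjointness of coordinate sets.\<close>

definition depends_on :: "'i set \<Rightarrow> (('i \<Rightarrow> 'a) \<Rightarrow> 'b) \<Rightarrow> bool" where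
  "depends_on J f \<longleftrightarrow> (\<forall>s t. (\<forall>j\<in>J. s j = t j) \<longrightarrow> f s = f t)"

lemma depends_onD: "depends_on J f \<Longrightarrow> (\<And>j. j \<in> J \<Longrightarrow> s j = t j) \<Longrightarrow> f s = f t"
  by (auto simp: depends_on_def)

lemma expectation_Pi_pmf_depends_on:
  fixes f :: "('i \<Rightarrow> 'a) \<Rightarrow> real"
  assumes I: "finite I" and f: "depends_on J f"
  shows "measure_pmf.expectation (Pi_pmf I d p) f = measure_pmf.expectation (Pi_pmf (I \<inter> J) d p) f"
proof -
  have "measure_pmf.expectation (Pi_pmf (I \<inter> J) d p) f =
      measure_pmf.expectation (Pi_pmf I d p) (\<lambda>s. f (\<lambda>i. if i \<in> I \<inter> J then s i else d))"
    unfolding Pi_pmf_subset[OF I, of "I \<inter> J", simplified] by simp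
  also have "\<dots> = measure_pmf.expectation (Pi_pmf I d p) f"
  proof (intro integral_cong_AE)
    show "AE s in measure_pmf (Pi_pmf I d p). f (\<lambda>i. if i \<in> I \<inter> J then s i else d) = f s"
      unfolding AE_measure_pmf_iff
    proof
      fix s assume "s \<in> set_pmf (Pi_pmf I d p)"
      \<comment> \<open>The set \<open>J\<close> may reach outside \<open>I\<close>, where
        \<open>f\<close> still reads its argument. On the support those coordinates carry the
        default \<open>d\<close>, so overwriting them with \<open>d\<close> changes nothing.\<close>
      then have "s i = d" if "i \<notin> I" for i
        using set_Pi_pmf_subset[OF I, of d p] that by auto
      then show "f (\<lambda>i. if i \<in> I \<inter> J then s i else d) = f s"
        by (intro depends_onD[OF f]) auto
    qed
  qed auto
  finally show ?thesis ..
qed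

text \<open>Independence of functions of disjoint coordinates. The bounds are asked for on the
  support only, since some later factors are bounded merely because the support is finite.\<close>

lemma expectation_Pi_pmf_mult:
  fixes f g :: "('i \<Rightarrow> 'a) \<Rightarrow> real"
  assumes I: "finite I" and dis: "J \<inter> K = {}"
    and f: "depends_on J f" "\<And>s. s \<in> set_pmf (Pi_pmf I d p) \<Longrightarrow> \<bar>f s\<bar> \<le> B" 
    and g: "depends_on K g" "\<And>s. s \<in> set_pmf (Pi_pmf I d p) \<Longrightarrow> \<bar>g s\<bar> \<le> C"
  shows "measure_pmf.expectation (Pi_pmf I d p) (\<lambda>s. f s * g s) =
    measure_pmf.expectation (Pi_pmf I d p) f * measure_pmf.expectation (Pi_pmf I d p) g"
proof -
  \<comment> \<open>The two blocks must cover \<open>I\<close>, so the second is the complement of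
    \<open>J\<close>; by disjointness it contains all of \<open>K\<close> that lies in
    \<open>I\<close>.\<close>
  let ?J = "I \<inter> J" and ?K = "I - J"
  let ?h = "\<lambda>s t i. if i \<in> ?J then s i else t i"
  have fin: "finite ?J" "finite ?K" and un: "?J \<union> ?K = I"
    using I by auto
  have Pi: "Pi_pmf I d p =
      bind_pmf (Pi_pmf ?J d p) (\<lambda>s. map_pmf (\<lambda>t. ?h s t) (Pi_pmf ?K d p))"
    using Pi_pmf_union[OF fin, of d p] unfolding un
    by (auto simp: pair_pmf_def map_pmf_def bind_assoc_pmf bind_return_pmf)
  have eq: "f (?h s t) = f s" "g (?h s t) = g t" 
    if s: "s \<in> set_pmf (Pi_pmf ?J d p)" and t: "t \<in> set_pmf (Pi_pmf ?K d p)" for s t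
  proof -
    have "s i = d" if "i \<notin> I" for i using s that fin set_Pi_pmf_subset[of ?J d p] by auto
    moreover have "t i = d" if "i \<notin> I" for i using t that fin set_Pi_pmf_subset[of ?K d p] by auto
    ultimately show "f (?h s t) = f s" "g (?h s t) = g t"
      using dis by (auto intro!: depends_onD[OF f(1)] depends_onD[OF g(1)])
  qed
  have bnd: "\<bar>f (?h s t)\<bar> \<le> B" "\<bar>g (?h s t)\<bar> \<le> C"
    if "s \<in> set_pmf (Pi_pmf ?J d p)" "t \<in> set_pmf (Pi_pmf ?K d p)" for s t
    using that by (auto simp: Pi intro!: f(2) g(2) bexI[of _ s])
  obtain s0 where s0: "s0 \<in> set_pmf (Pi_pmf ?J d p)" using set_pmf_not_empty by fast
  obtain t0 where t0: "t0 \<in> set_pmf (Pi_pmf ?K d p)" using set_pmf_not_empty by fast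
  have BC: "0 \<le> B" "0 \<le> C"
    using order_trans[OF abs_ge_zero bnd(1)[OF s0 t0]] order_trans[OF abs_ge_zero bnd(2)[OF s0 t0]] .
  have E: "measure_pmf.expectation (Pi_pmf I d p) F =
      measure_pmf.expectation (Pi_pmf ?J d p) (\<lambda>s. measure_pmf.expectation (Pi_pmf ?K d p) (\<lambda>t. F (?h s t)))"
    if "\<And>s t. s \<in> set_pmf (Pi_pmf ?J d p) \<Longrightarrow> t \<in> set_pmf (Pi_pmf ?K d p) \<Longrightarrow> \<bar>F (?h s t)\<bar> \<le> A"
    for F and A :: real
    unfolding Pi by (subst expectation_bind_pmf[where C = A]) (use that in auto)
  have cong: "measure_pmf.expectation (Pi_pmf ?J d p) (\<lambda>s. measure_pmf.expectation (Pi_pmf ?K d p) (F s)) =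
     measure_pmf.expectation (Pi_pmf ?J d p) (\<lambda>s. measure_pmf.expectation (Pi_pmf ?K d p) (G s))"
    if "\<And>s t. s \<in> set_pmf (Pi_pmf ?J d p) \<Longrightarrow> t \<in> set_pmf (Pi_pmf ?K d p) \<Longrightarrow> F s t = G s t"
    for F G :: "_ \<Rightarrow> _ \<Rightarrow> real"
    using that by (intro integral_cong_AE) (auto simp: AE_measure_pmf_iff intro!: integral_cong_AE)
  have "measure_pmf.expectation (Pi_pmf I d p) f = measure_pmf.expectation (Pi_pmf ?J d p) f"
    by (rule trans[OF E[of f B, OF bnd(1)] trans[OF cong[of _ "\<lambda>s t. f s", OF eq(1)]]]) simp_all
  moreover have "measure_pmf.expectation (Pi_pmf I d p) g = measure_pmf.expectation (Pi_pmf ?K d p) g"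
    by (rule trans[OF E[of g C, OF bnd(2)] trans[OF cong[of _ "\<lambda>s t. g t", OF eq(2)]]]) simp_all
  moreover have "measure_pmf.expectation (Pi_pmf I d p) (\<lambda>s. f s * g s) =
      measure_pmf.expectation (Pi_pmf ?J d p) f * measure_pmf.expectation (Pi_pmf ?K d p) g"
  proof -
    have "\<bar>f (?h s t) * g (?h s t)\<bar> \<le> B * C"
      if "s \<in> set_pmf (Pi_pmf ?J d p)" "t \<in> set_pmf (Pi_pmf ?K d p)" for s t
      unfolding abs_mult by (rule mult_mono[OF bnd[OF that] BC(1)]) simp
    then have "measure_pmf.expectation (Pi_pmf I d p) (\<lambda>s. f s * g s) =
        measure_pmf.expectation (Pi_pmf ?J d p) (\<lambda>s.
          measure_pmf.expectation (Pi_pmf ?K d p) (\<lambda>t. f (?h s t) * g (?h s t)))"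
      by (rule E)
    also have "\<dots> = measure_pmf.expectation (Pi_pmf ?J d p) (\<lambda>s.
        measure_pmf.expectation (Pi_pmf ?K d p) (\<lambda>t. f s * g t))"
      by (rule cong) (simp only: eq)
    finally show ?thesis by simp
  qed
  ultimately show ?thesis by simp
qed

lemma expectation_Pi_pmf_component:
  fixes g :: "'a \<Rightarrow> real"
  assumes "finite I" "i \<in> I"
  shows "measure_pmf.expectation (Pi_pmf I d p) (\<lambda>s. g (s i)) = measure_pmf.expectation (p i) g"
proof -
  have "map_pmf (\<lambda>s. s i) (Pi_pmf I d p) = p i"
    using assms by (simp add: Pi_pmf_component)
  then show ?thesis using integral_map_pmf[of "\<lambda>s. s i" "Pi_pmf I d p" g] by simp
qed

lemma expectation_bool_pmf:
  fixes f :: "bool \<Rightarrow> real"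
  shows "measure_pmf.expectation p f = pmf p True * f True + pmf p False * f False"
  by (subst integral_measure_pmf[of UNIV]) (auto simp: UNIV_bool)

lemma pmf_bool_sum: "pmf p True + pmf p False = 1"
  using expectation_bool_pmf[of p "\<lambda>_. 1"] by simp

section \<open>Probing trees\<close>

text \<open>A run reads only the states of edges it probes. The premise concerns runs under
  \<open>st\<close> alone, because the induction follows the branches that \<open>st\<close>
  selects.\<close>

lemma run_fun_upd:
  assumes "\<And>es M. (es, M) \<in> set_pmf (run st T) \<Longrightarrow> e \<notin> set es"
  shows "run (st(e := b)) T = run st T"
  using assms
proof (induction T)
  case (Randomise D)
  have "run (st(e := b)) S = run st S" if "S \<in> set_pmf D" for S
    by (rule Randomise.IH[OF that]) (use Randomise.prems that in force)
  then show ?case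
    unfolding run.simps by (metis (no_types, lifting) map_pmf_cong)
next
  case (Probe f T c A R)
  have "e \<noteq> f"
  proof -
    obtain z where "z \<in> set_pmf (run st (Probe f T c A R))" using set_pmf_not_empty by fast
    moreover from this have "f \<in> set (fst z)" by (auto split: if_splits)
    ultimately show ?thesis using Probe.prems by (cases z) auto
  qed
  define st' where "st' = st(e := b)"
  have st'_f: "st' f = st f" using \<open>e \<noteq> f\<close> by (simp add: st'_def)
  note IH = Probe.IH[folded st'_def]
  have "run st' (Probe f T c A R) = run st (Probe f T c A R)"
  proof (cases "st f")
    case True
    have "run st' A = run st A" if "True \<in> set_pmf c"
      using that True Probe.prems by (intro IH) force
    moreover have "run st' R = run st R" if "False \<in> set_pmf c"
      using that True Probe.prems by (intro IH) force
    ultimately show ?thesis using True st'_f by (auto intro!: bind_pmf_cong)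
  next
    case False
    have "run st' T = run st T"
      using False Probe.prems by (intro IH) force
    then show ?thesis using False st'_f by simp
  qed
  then show ?case by (simp only: st'_def)
qed simp

lemma run_added_subset_probed: "(es, M) \<in> set_pmf (run st T) \<Longrightarrow> M \<subseteq> set es"
proof (induction T arbitrary: es M)
  case (Probe e T c A R)
  from Probe.prems show ?case by (auto split: if_splits dest!: Probe.IH)
qed auto

text \<open>The predicate is a parameter because it changes along the tree: below a probe of
  \<open>e\<close> it speaks of the outcome with \<open>e\<close> put back in front.\<close>

definition all_outcomes :: "('e list \<Rightarrow> 'e set \<Rightarrow> bool) \<Rightarrow> 'e probing_tree \<Rightarrow> bool" where
  "all_outcomes Q T \<longleftrightarrow> (\<forall>st es M. (es, M) \<in> set_pmf (run st T) \<longrightarrow> Q es M)"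

lemma all_outcomesD: "all_outcomes Q T \<Longrightarrow> (es, M) \<in> set_pmf (run st T) \<Longrightarrow> Q es M"
  by (auto simp: all_outcomes_def)

lemma all_outcomes_RandomiseD: "all_outcomes Q (Randomise D) \<Longrightarrow> T \<in> set_pmf D \<Longrightarrow> all_outcomes Q T"
  by (auto simp: all_outcomes_def)

lemma all_outcomes_run_fun_upd:
  assumes "all_outcomes Q T" "\<And>es M. Q es M \<Longrightarrow> e \<notin> set es"
  shows "run (st(e := b)) T = run st T"
  by (rule run_fun_upd) (use assms all_outcomesD in blast)

text \<open>A subtree is reached only for one value of \<open>st e\<close>, yet the conclusion
  covers all states. Distinctness prevents the subtree from probing \<open>e\<close> again, so it
  runs alike for both values. The two active branches are constrained only if \<open>c\<close> gives
  them positive probability.\<close>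

lemma all_outcomes_ProbeD:
  assumes Q: "all_outcomes Q (Probe e T c A R)" and dist: "\<And>es M. Q es M \<Longrightarrow> distinct es"
  shows "all_outcomes (\<lambda>es M. Q (e # es) M) T"
    and "True \<in> set_pmf c \<Longrightarrow> all_outcomes (\<lambda>es M. Q (e # es) (insert e M)) A"
    and "False \<in> set_pmf c \<Longrightarrow> all_outcomes (\<lambda>es M. Q (e # es) M) R"
proof -
  \<comment> \<open>The premise applies at \<open>st(e := b)\<close>; from there the original value
    of \<open>e\<close> is restored.\<close>
  have upd: "run (st(e := b)) S = run st S"
    if "\<And>st es M. st e = b \<Longrightarrow> (es, M) \<in> set_pmf (run st S) \<Longrightarrow> e \<notin> set es" for b S st
    using run_fun_upd[of "st(e := b)" S e "st e"] that[of "st(e := b)"] by fastforce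
  have T: "Q (e # es) M" if "\<not> st e" "(es, M) \<in> set_pmf (run st T)" for st es M
    by (rule all_outcomesD[OF Q, of _ _ st])
       (use that in \<open>auto intro!: image_eqI[of _ _ "(es, M)"]\<close>)
  have "run (st(e := False)) T = run st T" for st
    by (rule upd) (use T dist in force)
  then show "all_outcomes (\<lambda>es M. Q (e # es) M) T"
    unfolding all_outcomes_def using T by (metis fun_upd_same)
  show "all_outcomes (\<lambda>es M. Q (e # es) (insert e M)) A" if c: "True \<in> set_pmf c"
  proof -
    have A: "Q (e # es) (insert e M)" if "st e" "(es, M) \<in> set_pmf (run st A)" for st es M
      by (rule all_outcomesD[OF Q, of _ _ st])
         (use that c in \<open>auto intro!: bexI[of _ True] image_eqI[of _ _ "(es, M)"]\<close>)
    have "run (st(e := True)) A = run st A" for st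
      by (rule upd) (use A dist in force)
    then show ?thesis
      unfolding all_outcomes_def using A by (metis fun_upd_same)
  qed
  show "all_outcomes (\<lambda>es M. Q (e # es) M) R" if c: "False \<in> set_pmf c"
  proof -
    have R: "Q (e # es) M" if "st e" "(es, M) \<in> set_pmf (run st R)" for st es M
      by (rule all_outcomesD[OF Q, of _ _ st])
         (use that c in \<open>auto intro!: bexI[of _ False] image_eqI[of _ _ "(es, M)"]\<close>)
    have "run (st(e := True)) R = run st R" for st
      by (rule upd) (use R dist in force)
    then show ?thesis
      unfolding all_outcomes_def using R by (metis fun_upd_same)
  qed
qed

definition add_prob :: "'e \<Rightarrow> 'e probing_tree \<Rightarrow> ('e \<Rightarrow> bool) \<Rightarrow> real" where
  "add_prob f T st = pmf (map_pmf (\<lambda>(es, M). f \<in> M) (run st T)) True"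

lemma add_prob_bounds: "0 \<le> add_prob f T st" "add_prob f T st \<le> 1"
  by (auto simp: add_prob_def pmf_le_1)

lemma add_prob_Randomise:
  "add_prob f (Randomise D) st = measure_pmf.expectation D (\<lambda>T. add_prob f T st)"
  by (simp add: add_prob_def map_join_pmf pmf_join pmf.map_comp o_def)

lemma add_prob_Probe:
  "add_prob f (Probe e T c A R) st =
     (if st e then pmf c True * (if f = e then 1 else add_prob f A st) +
        pmf c False * add_prob f R st
      else add_prob f T st)"
proof (cases "st e")
  case True
  have "map_pmf (\<lambda>(es, M). f \<in> M) (map_pmf (\<lambda>(es, M). (e # es, insert e M)) (run st A)) =
    (if f = e then return_pmf True else map_pmf (\<lambda>(es, M). f \<in> M) (run st A))"
    by (auto simp: pmf.map_comp o_def case_prod_unfold)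
  moreover have "map_pmf (\<lambda>(es, M). f \<in> M) (map_pmf (\<lambda>(es, M). (e # es, M)) (run st R)) =
    map_pmf (\<lambda>(es, M). f \<in> M) (run st R)"
    by (auto simp: pmf.map_comp o_def case_prod_unfold)
  ultimately show ?thesis using True
    by (auto simp: add_prob_def map_bind_pmf pmf_bind expectation_bool_pmf pmf_eq_0_set_pmf)
next
  case False
  then show ?thesis by (auto simp: add_prob_def pmf.map_comp o_def case_prod_unfold)
qed

lemma add_prob_eq_0:
  assumes "all_outcomes Q T" "\<And>es M. Q es M \<Longrightarrow> f \<notin> M"
  shows "add_prob f T = (\<lambda>_. 0)"
proof
  fix st
  have "f \<notin> M" if "(es, M) \<in> set_pmf (run st T)" for es M
    using all_outcomesD[OF assms(1) that] assms(2) by blast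
  then show "add_prob f T st = 0" by (auto simp: add_prob_def pmf_eq_0_set_pmf)
qed

lemma add_prob_depends_on:
  assumes "all_outcomes Q T" "\<And>es M. Q es M \<Longrightarrow> e \<notin> set es"
  shows "depends_on (- {e}) (add_prob f T)"
  unfolding depends_on_def
proof (intro allI impI)
  fix s t :: "'a \<Rightarrow> bool" assume "\<forall>j\<in>- {e}. s j = t j"
  then have "s = t(e := s e)" by (intro ext) (simp add: fun_upd_def)
  then have "run s T = run (t(e := s e)) T" by (rule arg_cong)
  also have "\<dots> = run t T"
    by (rule all_outcomes_run_fun_upd[OF assms(1)]) (rule assms(2))
  finally show "add_prob f T s = add_prob f T t"
    by (simp add: add_prob_def)
qed

text \<open>Deferred decisions: no subtree reads the state of \<open>e\<close> again, so that state
  can be averaged as if drawn at the moment of the probe. The subtrees may still be averaged over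
  all of \<open>P\<close>, because the coordinate \<open>e\<close> does not influence them.\<close>

lemma expectation_add_prob_Probe:
  fixes e f :: 'e and sp :: "'e \<Rightarrow> bool pmf"
  assumes E: "finite E" "e \<in> E" and Q: "all_outcomes Q (Probe e T c A R)"
    and dist: "\<And>es M. Q es M \<Longrightarrow> distinct es"
  defines "P \<equiv> Pi_pmf E False sp"
  shows "measure_pmf.expectation P (add_prob f (Probe e T c A R)) =
    pmf (sp e) True * (pmf c True * (if f = e then 1 else measure_pmf.expectation P (add_prob f A)) +
      pmf c False * measure_pmf.expectation P (add_prob f R)) +
    pmf (sp e) False * measure_pmf.expectation P (add_prob f T)"
proof -
  note sub = all_outcomes_ProbeD[OF Q]
  have notin: "e \<notin> set es" if "Q (e # es) M" for es M
    using dist[OF that] by simp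
  have st_e: "measure_pmf.expectation P (\<lambda>st. of_bool (st e = b)) = pmf (sp e) b" for b
    unfolding P_def expectation_Pi_pmf_component[OF E, where g = "\<lambda>s. of_bool (s = b)"]
    by (cases b) (auto simp: expectation_bool_pmf)
  have fin: "finite (set_pmf P)"
    unfolding P_def using E by (auto simp: set_Pi_pmf)
  note [simp] = integrable_measure_pmf_finite[OF fin]
  have split: "measure_pmf.expectation P (\<lambda>st. of_bool (st e = b) * add_prob f S st) =
      pmf (sp e) b * measure_pmf.expectation P (add_prob f S)"
    if "all_outcomes Q' S" "\<And>es M. Q' es M \<Longrightarrow> e \<notin> set es" for b S Q'
  proof -
    have "depends_on {e} (\<lambda>st. of_bool (st e = b) :: real)"
      by (auto simp: depends_on_def)
    then show ?thesis
      unfolding st_e[symmetric] P_def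
      by (intro expectation_Pi_pmf_mult[OF E(1), where J = "{e}" and K = "- {e}" and B = 1 and C = 1])
         (use add_prob_depends_on[OF that, where f = f] in \<open>auto simp: add_prob_bounds\<close>)
  qed
  have A: "measure_pmf.expectation P (\<lambda>st. pmf c True * (of_bool (st e = True) * (if f = e then 1 else add_prob f A st))) =
      pmf (sp e) True * (pmf c True * (if f = e then 1 else measure_pmf.expectation P (add_prob f A)))"
  \<comment> \<open>A branch of probability 0 may violate the invariant, but its coefficient removes
    it; for \<open>f = e\<close> the edge has just been added and the content of \<open>A\<close> is
    irrelevant.\<close>
  proof (cases "True \<in> set_pmf c \<and> f \<noteq> e")
    case True
    then have "measure_pmf.expectation P (\<lambda>st. of_bool (st e = True) * add_prob f A st) =
        pmf (sp e) True * measure_pmf.expectation P (add_prob f A)"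
      by (intro split[OF sub(2)]) (use notin dist in auto)
    then show ?thesis using True by simp
  next
    case False
    then show ?thesis using st_e[of True] by (auto simp: pmf_eq_0_set_pmf)
  qed
  have R: "measure_pmf.expectation P (\<lambda>st. pmf c False * (of_bool (st e = True) * add_prob f R st)) =
      pmf (sp e) True * (pmf c False * measure_pmf.expectation P (add_prob f R))"
  proof (cases "False \<in> set_pmf c")
    case True
    then have "measure_pmf.expectation P (\<lambda>st. of_bool (st e = True) * add_prob f R st) =
        pmf (sp e) True * measure_pmf.expectation P (add_prob f R)"
      by (intro split[OF sub(3)]) (use notin dist in auto)
    then show ?thesis by simp
  qed (auto simp: pmf_eq_0_set_pmf)
  have T: "measure_pmf.expectation P (\<lambda>st. of_bool (st e = False) * add_prob f T st) =
      pmf (sp e) False * measure_pmf.expectation P (add_prob f T)"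
    by (rule split[OF sub(1)]) (use notin dist in auto)
  have "measure_pmf.expectation P (add_prob f (Probe e T c A R)) =
     measure_pmf.expectation P (\<lambda>st. pmf c True * (of_bool (st e = True) * (if f = e then 1 else add_prob f A st)) +
       pmf c False * (of_bool (st e = True) * add_prob f R st) + of_bool (st e = False) * add_prob f T st)"
    by (intro Bochner_Integration.integral_cong) (auto simp: add_prob_Probe pmf_eq_0_set_pmf)
  also have "\<dots> = measure_pmf.expectation P (\<lambda>st. pmf c True * (of_bool (st e = True) * (if f = e then 1 else add_prob f A st))) +
       measure_pmf.expectation P (\<lambda>st. pmf c False * (of_bool (st e = True) * add_prob f R st)) +
       measure_pmf.expectation P (\<lambda>st. of_bool (st e = False) * add_prob f T st)"
    by (subst Bochner_Integration.integral_add, simp, simp)+ simp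
  finally show ?thesis unfolding A R T by (simp add: algebra_simps)
qed

section \<open>Reducing a probing tree to strings at a single vertex\<close>

text \<open>
  Viewed from a single online vertex \<open>v\<close>, a probing tree behaves like a random string of
  edges at \<open>v\<close>, probed until the first active one, with the same probabilities of each edge
  being added. Whether an active edge is added is decided before its state is revealed: an edge
  that would be rejected anyway is left out of the string, and its state, like those of the
  edges at other vertices, is simulated.
\<close>

primrec vertex_string ::
    "('u \<times> 'v \<Rightarrow> bool pmf) \<Rightarrow> 'v \<Rightarrow> ('u \<times> 'v) probing_tree \<Rightarrow> ('u \<times> 'v) list pmf" where
  "vertex_string sp v Halt = return_pmf []"
| "vertex_string sp v (Randomise D) = join_pmf (map_pmf (vertex_string sp v) D)"
| "vertex_string sp v (Probe e T c A R) =
     (if snd e = v then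
        bind_pmf c (\<lambda>add.
          if add then map_pmf ((#) e) (vertex_string sp v T)
          else bind_pmf (sp e) (\<lambda>act. if act then vertex_string sp v R else vertex_string sp v T))
      else
        bind_pmf (sp e) (\<lambda>act.
          if act then bind_pmf c (\<lambda>add. if add then vertex_string sp v A else vertex_string sp v R)
          else vertex_string sp v T))"

text \<open>For a string without repetitions and independent states of law \<open>sp\<close>, this
  is the probability that probing in order finds \<open>f\<close> as the first active edge. It is
  the coefficient of a string in the capacity constraint of the LP.\<close>

definition first_active_prob :: "('e \<Rightarrow> bool pmf) \<Rightarrow> 'e \<Rightarrow> 'e list \<Rightarrow> real" where
  "first_active_prob sp f es =
     (if f \<in> set es then pmf (sp f) True * (\<Prod>e\<leftarrow>before es f. pmf (sp e) False) else 0)"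

lemma first_active_prob_Nil [simp]: "first_active_prob sp f [] = 0"
  by (simp add: first_active_prob_def)

lemma first_active_prob_Cons [simp]:
  "first_active_prob sp f (e # es) =
     (if e = f then pmf (sp f) True else pmf (sp e) False * first_active_prob sp f es)"
  by (auto simp: first_active_prob_def before_def)

lemma first_active_prob_bounds: "0 \<le> first_active_prob sp f es" "first_active_prob sp f es \<le> 1"
  by (induction es) (auto simp: pmf_le_1 mult_le_one)

text \<open>Each drawn string follows a branch of the tree; putting \<open>e\<close> into the string
  means following the branch where \<open>e\<close> is inactive. Edges that the string skips are
  still probed on the branch, hence a subsequence and not a contiguous piece.\<close>

lemma vertex_string_subseq_probed:
  assumes "all_outcomes Q T" "\<And>es M. Q es M \<Longrightarrow> distinct es" "es \<in> set_pmf (vertex_string sp v T)"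
  shows "\<exists>fs M. Q fs M \<and> subseq es (filter (\<lambda>e. snd e = v) fs)"
  using assms
proof (induction T arbitrary: Q es)
  case Halt
  then show ?case by (auto simp: all_outcomes_def)
next
  case (Randomise D)
  from Randomise.prems(3) obtain S where "S \<in> set_pmf D" "es \<in> set_pmf (vertex_string sp v S)"
    by auto
  with Randomise.IH[OF this(1) all_outcomes_RandomiseD[OF Randomise.prems(1) this(1)]] Randomise.prems(2)
  show ?case by blast
next
  case (Probe e T c A R)
  note sub = all_outcomes_ProbeD[OF Probe.prems(1), OF Probe.prems(2)]
  have dist: "distinct fs" if "Q (e # fs) M" for fs M
    using Probe.prems(2)[OF that] by simp
  have T: "\<exists>fs M. Q (e # fs) M \<and> subseq es' (filter (\<lambda>e. snd e = v) fs)"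
    if "es' \<in> set_pmf (vertex_string sp v T)" for es'
    by (rule Probe.IH(1)[OF sub(1) _ that]) (auto dest: dist)
  have A: "\<exists>fs M. Q (e # fs) (insert e M) \<and> subseq es' (filter (\<lambda>e. snd e = v) fs)"
    if "True \<in> set_pmf c" "es' \<in> set_pmf (vertex_string sp v A)" for es'
    by (rule Probe.IH(2)[OF sub(2)[OF _ that(1)] _ that(2)]) (auto dest: dist)
  have R: "\<exists>fs M. Q (e # fs) M \<and> subseq es' (filter (\<lambda>e. snd e = v) fs)"
    if "False \<in> set_pmf c" "es' \<in> set_pmf (vertex_string sp v R)" for es'
    by (rule Probe.IH(3)[OF sub(3)[OF _ that(1)] _ that(2)]) (auto dest: dist)
  consider (add) es' where "snd e = v" "es = e # es'" "es' \<in> set_pmf (vertex_string sp v T)"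
    | (T) "es \<in> set_pmf (vertex_string sp v T)"
    | (A) "snd e \<noteq> v" "True \<in> set_pmf c" "es \<in> set_pmf (vertex_string sp v A)"
    | (R) "False \<in> set_pmf c" "es \<in> set_pmf (vertex_string sp v R)"
    using Probe.prems(3) by (auto split: if_splits) (metis (full_types))+
  then show ?case
  proof cases
    case add
    from T[OF add(3)] obtain fs M where "Q (e # fs) M" "subseq es' (filter (\<lambda>e. snd e = v) fs)"
      by blast
    then show ?thesis using add by (intro exI[of _ "e # fs"] exI[of _ M]) auto
  next
    case T': T
    from T[OF T'] obtain fs M where "Q (e # fs) M" "subseq es (filter (\<lambda>e. snd e = v) fs)"
      by blast
    then show ?thesis by (intro exI[of _ "e # fs"] exI[of _ M]) auto
  next
    case A': A
    from A[OF A'(2,3)] obtain fs M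
      where "Q (e # fs) (insert e M)" "subseq es (filter (\<lambda>e. snd e = v) fs)"
      by blast
    then show ?thesis by (intro exI[of _ "e # fs"] exI[of _ "insert e M"]) auto
  next
    case R': R
    from R[OF R'] obtain fs M where "Q (e # fs) M" "subseq es (filter (\<lambda>e. snd e = v) fs)"
      by blast
    then show ?thesis by (intro exI[of _ "e # fs"] exI[of _ M]) auto
  qed
qed

text \<open>Both sides obey almost the same recursion, and the terms in which they differ vanish. If
  \<open>f = e\<close>, then \<open>T\<close> and \<open>R\<close> cannot add \<open>f\<close>
  later, as this would need a second probe. If \<open>e\<close> is another edge at the vertex of
  \<open>f\<close>, then \<open>A\<close> cannot add \<open>f\<close>, as the result would not be a
  matching.\<close>

theorem expectation_add_prob_eq_vertex_string:
  fixes f :: "'u \<times> 'v"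
  assumes E: "finite E" and Q: "all_outcomes Q T"
    and Q': "\<And>es M. Q es M \<Longrightarrow> distinct es \<and> set es \<subseteq> E \<and> is_matching M"
  shows "measure_pmf.expectation (Pi_pmf E False sp) (add_prob f T) =
    measure_pmf.expectation (vertex_string sp (snd f) T) (first_active_prob sp f)"
  using Q Q'
proof (induction T arbitrary: Q)
  case Halt
  then show ?case by (simp add: add_prob_def)
next
  case (Randomise D)
  have "measure_pmf.expectation (Pi_pmf E False sp) (add_prob f (Randomise D)) =
    measure_pmf.expectation D (\<lambda>S. measure_pmf.expectation (Pi_pmf E False sp) (add_prob f S))"
    unfolding add_prob_Randomise
    by (rule expectation_swap_pmf[where C = 1]) (simp add: add_prob_bounds)
  also have "\<dots> = measure_pmf.expectation D (\<lambda>S.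
      measure_pmf.expectation (vertex_string sp (snd f) S) (first_active_prob sp f))"
    by (intro integral_cong_AE)
      (auto simp: AE_measure_pmf_iff intro!: Randomise.IH[OF _ all_outcomes_RandomiseD[OF Randomise.prems(1)]]
         dest: Randomise.prems(2))
  also have "\<dots> = measure_pmf.expectation (vertex_string sp (snd f) (Randomise D)) (first_active_prob sp f)"
    unfolding vertex_string.simps bind_eq_join_pmf[symmetric]
    by (rule expectation_bind_pmf[where C = 1, symmetric]) (simp add: first_active_prob_bounds)
  finally show ?case .
next
  case (Probe e T c A R)
  let ?P = "Pi_pmf E False sp"
  let ?E = "\<lambda>S. measure_pmf.expectation (vertex_string sp (snd f) S) (first_active_prob sp f)"
  have dist: "distinct es" if "Q es M" for es M
    using Probe.prems(2)[OF that] by simp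
  note sub = all_outcomes_ProbeD[OF Probe.prems(1), OF dist]
  have Q'': "distinct es \<and> set es \<subseteq> E \<and> is_matching M"
    if "Q (e # es) M" for es M
    using Probe.prems(2)[OF that] by auto
  have Qins: "distinct es \<and> set es \<subseteq> E \<and> is_matching M \<and> (\<forall>g\<in>M. g \<noteq> e \<longrightarrow> snd g \<noteq> snd e)"
    if "Q (e # es) (insert e M)" for es M
    using Probe.prems(2)[OF that] by (auto simp: is_matching_def)
  have "e \<in> E"
  proof -
    obtain z where z: "z \<in> set_pmf (run (\<lambda>_. False) (Probe e T c A R))"
      using set_pmf_not_empty by fast
    then have "e \<in> set (fst z)" by auto
    moreover have "Q (fst z) (snd z)"
      by (rule all_outcomesD[OF Probe.prems(1), of _ _ "\<lambda>_. False"]) (use z in simp)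
    ultimately show ?thesis
      using Probe.prems(2)[of "fst z" "snd z"] by auto
  qed
  have T: "measure_pmf.expectation ?P (add_prob f T) = ?E T"
    by (rule Probe.IH(1)[OF sub(1)]) (use Q'' in auto)
  have A: "pmf c True * measure_pmf.expectation ?P (add_prob f A) = pmf c True * ?E A"
  proof (cases "True \<in> set_pmf c")
    case True
    have "measure_pmf.expectation ?P (add_prob f A) = ?E A"
      by (rule Probe.IH(2)[OF sub(2)[OF _ True]]) (use Qins in auto)
    then show ?thesis by simp
  qed (simp add: pmf_eq_0_set_pmf)
  have R: "pmf c False * measure_pmf.expectation ?P (add_prob f R) = pmf c False * ?E R"
  proof (cases "False \<in> set_pmf c")
    case True
    have "measure_pmf.expectation ?P (add_prob f R) = ?E R"
      by (rule Probe.IH(3)[OF sub(3)[OF _ True]]) (use Q'' in auto)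
    then show ?thesis by simp
  qed (simp add: pmf_eq_0_set_pmf)
  have "measure_pmf.expectation ?P (add_prob f (Probe e T c A R)) =
      pmf (sp e) True * (pmf c True * (if f = e then 1 else measure_pmf.expectation ?P (add_prob f A)) +
        pmf c False * measure_pmf.expectation ?P (add_prob f R)) +
      pmf (sp e) False * measure_pmf.expectation ?P (add_prob f T)"
    by (rule expectation_add_prob_Probe[OF E \<open>e \<in> E\<close> Probe.prems(1)]) (rule dist)
  then have lhs: "measure_pmf.expectation ?P (add_prob f (Probe e T c A R)) =
      pmf (sp e) True * (pmf c True * (if f = e then 1 else ?E A) + pmf c False * ?E R) +
      pmf (sp e) False * ?E T"
    using A unfolding T R by (cases "f = e") auto
  note bind = expectation_bind_pmf[where C = 1] and bnd = first_active_prob_bounds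
  show ?case
  proof (cases "snd e = snd f")
    case False
    have "?E (Probe e T c A R) =
        pmf (sp e) True * (pmf c True * ?E A + pmf c False * ?E R) + pmf (sp e) False * ?E T"
      using False by (simp add: bind bnd expectation_bool_pmf)
    then show ?thesis using lhs False by auto
  next
    case True
    have cons: "measure_pmf.expectation (vertex_string sp (snd f) T) (\<lambda>es. first_active_prob sp f (e # es)) =
      (if e = f then pmf (sp f) True else pmf (sp e) False * ?E T)"
      by simp
    have rhs: "?E (Probe e T c A R) =
        pmf c True * (if e = f then pmf (sp f) True else pmf (sp e) False * ?E T) +
        pmf c False * (pmf (sp e) True * ?E R + pmf (sp e) False * ?E T)"
      using True cons by (simp add: bind bnd expectation_bool_pmf)
    show ?thesis
    proof (cases "f = e")
      case True
      \<comment> \<open>Added edges have been probed, so with this fact in the invariant,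
        distinctness of \<open>e # es\<close> keeps \<open>e\<close> out of
        \<open>M\<close>.\<close>
      have "measure_pmf.expectation ?P (add_prob f T) = 0"
      proof -
        have "add_prob f T = (\<lambda>_. 0)"
        proof (rule add_prob_eq_0)
          show "all_outcomes (\<lambda>es M. M \<subseteq> set es \<and> Q (e # es) M) T"
            using sub(1) run_added_subset_probed by (fastforce simp: all_outcomes_def)
          show "f \<notin> M" if "M \<subseteq> set es \<and> Q (e # es) M" for es M
            using that dist[of "e # es" M] True by auto
        qed
        then show ?thesis by simp
      qed
      moreover have "pmf c False * measure_pmf.expectation ?P (add_prob f R) = 0"
      proof (cases "False \<in> set_pmf c")
        case c: True
        have "add_prob f R = (\<lambda>_. 0)"
        proof (rule add_prob_eq_0)
          show "all_outcomes (\<lambda>es M. M \<subseteq> set es \<and> Q (e # es) M) R"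
            using sub(3)[OF _ c] run_added_subset_probed by (fastforce simp: all_outcomes_def)
          show "f \<notin> M" if "M \<subseteq> set es \<and> Q (e # es) M" for es M
            using that dist[of "e # es" M] True by auto
        qed
        then show ?thesis by simp
      qed (simp add: pmf_eq_0_set_pmf)
      ultimately have "?E T = 0" "pmf c False * ?E R = 0"
        using T R by auto
      then show ?thesis unfolding lhs rhs using True by auto
    next
      case False
      have "pmf c True * ?E A = 0"
      proof (cases "True \<in> set_pmf c")
        case c: True
        have "add_prob f A = (\<lambda>_. 0)"
        proof (rule add_prob_eq_0)
          show "all_outcomes (\<lambda>es M. Q (e # es) (insert e M)) A"
            by (rule sub(2)[OF _ c])
          show "f \<notin> M" if "Q (e # es) (insert e M)" for es M
            using Qins[OF that] False \<open>snd e = snd f\<close> by metis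
        qed
        then show ?thesis using A by simp
      qed (simp add: pmf_eq_0_set_pmf)
      \<comment> \<open>The tree meets \<open>T\<close> once, whereas the string law reaches it
        after either value of the decision; the two weights of \<open>c\<close> sum to 1.\<close>
      moreover have "pmf (sp e) False * ?E T =
          pmf c True * (pmf (sp e) False * ?E T) + pmf c False * (pmf (sp e) False * ?E T)"
        using pmf_bool_sum[of c] by (simp flip: distrib_right)
      ultimately show ?thesis
        unfolding lhs rhs using False by (auto simp: distrib_left mult.left_commute)
    qed
  qed
qed

section \<open>Offline algorithms on a fixed graph: strings, values and marginals\<close>

locale probing_graph =
  fixes G :: "('u, 'v) sgraph"
  assumes finite_offline: "finite (offline G)" and finite_online: "finite (online G)"
    and pr_range: "e \<in> edges G \<Longrightarrow> 0 \<le> pr G e \<and> pr G e \<le> 1"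
    and constr_strings: "v \<in> online G \<Longrightarrow> constr G v \<subseteq> strings (incident G v)"
    and constr_subseq: "v \<in> online G \<Longrightarrow> es \<in> constr G v \<Longrightarrow> subseq fs es \<Longrightarrow> fs \<in> constr G v"
begin

lemma finite_edges: "finite (edges G)"
  by (simp add: edges_def finite_offline finite_online)

lemma constrD:
  assumes "v \<in> online G" "es \<in> constr G v"
  shows "distinct es" "set es \<subseteq> edges G" "set es \<subseteq> offline G \<times> {v}"
proof -
  have "es \<in> strings (incident G v)" using constr_strings assms by blast
  then show "distinct es" "set es \<subseteq> edges G" "set es \<subseteq> offline G \<times> {v}"
    by (auto simp: strings_def incident_def edges_def)
qed

lemma finite_constr: "v \<in> online G \<Longrightarrow> finite (constr G v)"
  by (rule finite_subset[OF _ finite_subset_distinct[OF finite_edges]]) (use constrD in blast)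

abbreviation "state_law \<equiv> \<lambda>e. bernoulli_pmf (pr G e)"

text \<open>\<open>bernoulli_pmf\<close> clips its argument to the unit interval; edges of a string
  have probabilities in that range, so nothing is clipped and the LP coefficient appears.\<close>

lemma first_active_prob_constr:
  assumes "v \<in> online G" "es \<in> constr G v"
  shows "first_active_prob state_law f es =
    (if f \<in> set es then pr G f * none_active G (before es f) else 0)"
proof -
  have "(\<Prod>e\<leftarrow>before es f. pmf (state_law e) False) = none_active G (before es f)"
    unfolding none_active_def
    using constrD(2)[OF assms] pr_range
    by (intro arg_cong[where f = prod_list] map_cong)
       (auto simp: before_def dest!: set_takeWhileD)
  then show ?thesis
    using constrD(2)[OF assms] pr_range[of f] by (auto simp: first_active_prob_def)
qed

text \<open>Expresses the LP objective through the same quantity as the capacity constraints, so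
  that one identity about \<open>first_active_prob\<close> serves both.\<close>

lemma string_val_constr:
  assumes "v \<in> online G" "es \<in> constr G v"
  shows "string_val G es = (\<Sum>u\<in>offline G. wt G (u, v) * first_active_prob state_law (u, v) es)"
proof -
  have "string_val G es = (\<Sum>e\<in>set es. wt G e * first_active_prob state_law e es)"
    unfolding string_val_def
    by (subst sum_list_distinct_conv_sum_set[OF constrD(1)[OF assms]], intro sum.cong)
       (simp_all add: first_active_prob_constr[OF assms])
  also have "\<dots> = (\<Sum>e\<in>offline G \<times> {v}. wt G e * first_active_prob state_law e es)"
    using constrD(3)[OF assms]
    by (intro sum.mono_neutral_left) (auto simp: finite_offline first_active_prob_def)
  also have "\<dots> = (\<Sum>u\<in>offline G. wt G (u, v) * first_active_prob state_law (u, v) es)"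
    by (intro sum.reindex_cong[of "\<lambda>u. (u, v)"]) (auto simp: inj_on_def)
  finally show ?thesis .
qed

end

lemma distinct_if_filters_distinct:
  assumes "\<And>v. v \<in> g ` set es \<Longrightarrow> distinct (filter (\<lambda>e. g e = v) es)"
  shows "distinct es"
  using assms
proof (induction es)
  case (Cons e es)
  have "distinct (filter (\<lambda>x. g x = v) es)" if "v \<in> g ` set es" for v
    using Cons.prems[of v] that by (auto split: if_splits)
  moreover have "e \<notin> set es"
    using Cons.prems[of "g e"] by auto
  ultimately show ?case using Cons.IH by simp
qed simp

lemma add_prob_eq_expectation:
  "add_prob f T st = measure_pmf.expectation (run st T) (\<lambda>(es, M). of_bool (f \<in> M))"
proof -
  have "add_prob f T st =
      measure_pmf.expectation (map_pmf (\<lambda>(es, M). f \<in> M) (run st T)) (\<lambda>b. of_bool b)"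
    by (simp only: add_prob_def expectation_bool_pmf) simp
  then show ?thesis unfolding integral_map_pmf by (simp add: case_prod_unfold)
qed

lemma integrable_indicator_run:
  "integrable (measure_pmf (run st T)) (\<lambda>(es, M). of_bool (f \<in> M) :: real)"
  by (rule measure_pmf.integrable_const_bound[where B = 1]) auto

context probing_graph
begin

definition outcome_ok :: "('u \<times> 'v) list \<Rightarrow> ('u \<times> 'v) set \<Rightarrow> bool" where
  "outcome_ok es M \<longleftrightarrow> set es \<subseteq> edges G \<and>
  (\<forall>v\<in>online G. filter (\<lambda>e. snd e = v) es \<in> constr G v) \<and> is_matching M"

text \<open>The constraints speak of one vertex at a time. Together they exclude every repeated
  probe, because equal edges share their online vertex; this supplies the distinctness that all tree
  inductions require.\<close>

lemma outcome_ok_distinct: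
  assumes "outcome_ok es M"
  shows "distinct es"
proof (rule distinct_if_filters_distinct[where g = snd])
  fix v assume "v \<in> snd ` set es"
  then have "v \<in> online G" using assms by (auto simp: outcome_ok_def edges_def)
  then show "distinct (filter (\<lambda>e. snd e = v) es)"
    using assms constrD(1) by (auto simp: outcome_ok_def)
qed

lemma weight_bound: "M \<subseteq> edges G \<Longrightarrow> \<bar>weight G M\<bar> \<le> (\<Sum>e\<in>edges G. \<bar>wt G e\<bar>)"
  unfolding weight_def
  by (rule order_trans[OF sum_abs]) (auto intro!: sum_mono2 finite_edges)

lemma finite_edge_states: "finite (set_pmf (edge_states G))"
  unfolding edge_states_def using finite_edges by (auto simp: set_Pi_pmf)

context
  fixes T :: "('u \<times> 'v) probing_tree"
  assumes T: "offline_probing_algorithm G T"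
begin

lemma all_outcomes_ok: "all_outcomes outcome_ok T"
  using T unfolding offline_probing_algorithm_def all_outcomes_def outcome_ok_def by fast

lemma run_ok:
  assumes "(es, M) \<in> set_pmf (run st T)"
  shows "M \<subseteq> edges G" "is_matching M"
  using all_outcomesD[OF all_outcomes_ok assms] run_added_subset_probed[OF assms]
  by (auto simp: outcome_ok_def)

lemma expected_weight_eq_run:
  "expected_weight G T =
     measure_pmf.expectation (edge_states G) (\<lambda>st.
       measure_pmf.expectation (run st T) (\<lambda>(es, M). weight G M))"
  unfolding expected_weight_def
  by (rule expectation_bind_pmf[where C = "\<Sum>e\<in>edges G. \<bar>wt G e\<bar>"])
     (auto intro!: weight_bound dest: run_ok)

text \<open>A bound common to all algorithms: it makes the set in \<open>OPT\<close> bounded above,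
  as a meaningful real supremum requires.\<close>

lemma expected_weight_le: "expected_weight G T \<le> (\<Sum>e\<in>edges G. \<bar>wt G e\<bar>)"
  unfolding expected_weight_def
proof (rule measure_pmf.integral_le_const)
  let ?p = "bind_pmf (edge_states G) (\<lambda>st. run st T)"
  have *: "\<bar>case z of (es, M) \<Rightarrow> weight G M\<bar> \<le> (\<Sum>e\<in>edges G. \<bar>wt G e\<bar>)" if "z \<in> set_pmf ?p" for z
  proof -
    from that obtain st where "(fst z, snd z) \<in> set_pmf (run st T)" by auto
    from weight_bound[OF run_ok(1)[OF this]] show ?thesis by (simp add: case_prod_unfold)
  qed
  then show "integrable (measure_pmf ?p) (\<lambda>(es, M). weight G M)"
    by (intro measure_pmf.integrable_const_bound[where B = "\<Sum>e\<in>edges G. \<bar>wt G e\<bar>"])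
       (auto simp: AE_measure_pmf_iff)
  show "AE z in measure_pmf ?p. (case z of (es, M) \<Rightarrow> weight G M) \<le> (\<Sum>e\<in>edges G. \<bar>wt G e\<bar>)"
    unfolding AE_measure_pmf_iff using * by (meson abs_le_D1)
qed

lemma expected_weight_eq_add_prob:
  "expected_weight G T =
     (\<Sum>e\<in>edges G. wt G e * measure_pmf.expectation (edge_states G) (add_prob e T))"
proof -
  have "measure_pmf.expectation (run st T) (\<lambda>(es, M). weight G M) =
      (\<Sum>e\<in>edges G. wt G e * add_prob e T st)" for st
  proof -
    have "measure_pmf.expectation (run st T) (\<lambda>(es, M). weight G M) =
      measure_pmf.expectation (run st T)
        (\<lambda>z. \<Sum>e\<in>edges G. wt G e * (case z of (es, M) \<Rightarrow> of_bool (e \<in> M)))"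
    proof (intro integral_cong_AE)
      show "AE z in measure_pmf (run st T). (case z of (es, M) \<Rightarrow> weight G M) =
          (\<Sum>e\<in>edges G. wt G e * (case z of (es, M) \<Rightarrow> of_bool (e \<in> M)))"
        unfolding AE_measure_pmf_iff
      proof (intro ballI)
        fix z assume z: "z \<in> set_pmf (run st T)"
        then have "snd z \<subseteq> edges G" using run_ok(1)[of "fst z" "snd z" st] by simp
        then have "weight G (snd z) = (\<Sum>e\<in>edges G. if e \<in> snd z then wt G e else 0)"
          unfolding weight_def using finite_edges
          by (simp add: sum.inter_restrict[symmetric] Int_absorb1 Int_commute)
        also have "\<dots> = (\<Sum>e\<in>edges G. wt G e * of_bool (e \<in> snd z))"
          by (intro sum.cong) auto
        finally show "(case z of (es, M) \<Rightarrow> weight G M) =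
          (\<Sum>e\<in>edges G. wt G e * (case z of (es, M) \<Rightarrow> of_bool (e \<in> M)))"
          by (simp add: case_prod_unfold)
      qed
    qed auto
    also have "\<dots> = (\<Sum>e\<in>edges G. wt G e * add_prob e T st)"
      unfolding add_prob_eq_expectation
      by (subst Bochner_Integration.integral_sum)
         (auto intro!: integrable_mult_right integrable_indicator_run)
    finally show ?thesis .
  qed
  then show ?thesis
    unfolding expected_weight_eq_run
    by (simp add: Bochner_Integration.integral_sum integrable_measure_pmf_finite[OF finite_edge_states])
qed

text \<open>In every outcome at most one edge at \<open>u\<close> is added. After averaging over
  types this becomes the capacity constraint of the LP.\<close>

lemma sum_add_prob_le_1:
  "(\<Sum>v\<in>online G. measure_pmf.expectation (edge_states G) (add_prob (u, v) T)) \<le> 1"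
proof -
  have "(\<Sum>v\<in>online G. add_prob (u, v) T st) \<le> 1" for st
  proof -
    have "(\<Sum>v\<in>online G. add_prob (u, v) T st) = measure_pmf.expectation (run st T)
        (\<lambda>z. \<Sum>v\<in>online G. case z of (es, M) \<Rightarrow> of_bool ((u, v) \<in> M))"
      unfolding add_prob_eq_expectation
      by (subst Bochner_Integration.integral_sum) (auto intro!: integrable_indicator_run)
    also have "\<dots> \<le> 1"
    proof (rule measure_pmf.integral_le_const)
      show "integrable (measure_pmf (run st T))
          (\<lambda>z. \<Sum>v\<in>online G. case z of (es, M) \<Rightarrow> (of_bool ((u, v) \<in> M) :: real))"
        by (intro Bochner_Integration.integrable_sum integrable_indicator_run)
      show "AE z in measure_pmf (run st T).
          (\<Sum>v\<in>online G. case z of (es, M) \<Rightarrow> (of_bool ((u, v) \<in> M) :: real)) \<le> 1"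
        unfolding AE_measure_pmf_iff
      proof (intro ballI)
        fix z assume "z \<in> set_pmf (run st T)"
        then have "is_matching (snd z)" using run_ok(2)[of "fst z" "snd z" st] by simp
        then have "v = v'" if "(u, v) \<in> snd z" "(u, v') \<in> snd z" for v v'
          using that by (force simp: is_matching_def)
        then have "card {v \<in> online G. (u, v) \<in> snd z} \<le> 1"
          using finite_online by (simp add: card_le_Suc0_iff_eq)
        moreover have "(\<Sum>v\<in>online G. of_bool ((u, v) \<in> snd z)) =
            real (card {v \<in> online G. (u, v) \<in> snd z})"
          using finite_online by (simp add: Int_def)
        ultimately show "(\<Sum>v\<in>online G. case z of (es, M) \<Rightarrow> (of_bool ((u, v) \<in> M) :: real)) \<le> 1"
          by (simp add: case_prod_unfold)
      qed
    qed
    finally show ?thesis .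
  qed
  then have "measure_pmf.expectation (edge_states G) (\<lambda>st. \<Sum>v\<in>online G. add_prob (u, v) T st) \<le> 1"
    by (intro measure_pmf.integral_le_const integrable_measure_pmf_finite finite_edge_states) auto
  then show ?thesis
    by (simp add: Bochner_Integration.integral_sum integrable_measure_pmf_finite[OF finite_edge_states])
qed

lemma vertex_string_in_constr:
  assumes "v \<in> online G"
  shows "set_pmf (vertex_string state_law v T) \<subseteq> constr G v"
proof
  fix es assume es: "es \<in> set_pmf (vertex_string state_law v T)"
  have "\<exists>fs M. outcome_ok fs M \<and> subseq es (filter (\<lambda>e. snd e = v) fs)"
    by (rule vertex_string_subseq_probed[OF all_outcomes_ok _ es]) (rule outcome_ok_distinct)
  then show "es \<in> constr G v"
    using constr_subseq[OF assms] assms by (auto simp: outcome_ok_def)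
qed

lemma expectation_add_prob_eq:
  assumes "(u, v) \<in> edges G"
  shows "measure_pmf.expectation (edge_states G) (add_prob (u, v) T) =
    measure_pmf.expectation (vertex_string state_law v T) (first_active_prob state_law (u, v))"
  using expectation_add_prob_eq_vertex_string[OF finite_edges all_outcomes_ok, of state_law "(u, v)"]
    outcome_ok_distinct
  by (auto simp: edge_states_def outcome_ok_def)

lemma expected_weight_eq_string_val:
  "expected_weight G T =
     (\<Sum>v\<in>online G. measure_pmf.expectation (vertex_string state_law v T) (string_val G))"
proof -
  have "measure_pmf.expectation (vertex_string state_law v T) (string_val G) =
      (\<Sum>u\<in>offline G. wt G (u, v) * measure_pmf.expectation (edge_states G) (add_prob (u, v) T))"
    if v: "v \<in> online G" for v
  proof -
    have "measure_pmf.expectation (vertex_string state_law v T) (string_val G) =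
       measure_pmf.expectation (vertex_string state_law v T)
         (\<lambda>es. \<Sum>u\<in>offline G. wt G (u, v) * first_active_prob state_law (u, v) es)"
      using vertex_string_in_constr[OF v]
      by (intro integral_cong_AE) (auto simp: AE_measure_pmf_iff string_val_constr[OF v])
    also have "\<dots> = (\<Sum>u\<in>offline G. wt G (u, v) *
        measure_pmf.expectation (vertex_string state_law v T) (first_active_prob state_law (u, v)))"
      using finite_subset[OF vertex_string_in_constr[OF v] finite_constr[OF v]]
      by (subst Bochner_Integration.integral_sum) (auto intro!: integrable_measure_pmf_finite)
    also have "\<dots> = (\<Sum>u\<in>offline G. wt G (u, v) * measure_pmf.expectation (edge_states G) (add_prob (u, v) T))"
      using v by (intro sum.cong refl arg_cong2[where f = "(*)"] expectation_add_prob_eq[symmetric])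
        (auto simp: edges_def)
    finally show ?thesis .
  qed
  then show ?thesis
    unfolding expected_weight_eq_add_prob edges_def
    by (simp add: sum.cartesian_product' sum.swap[of _ "offline G"])
qed

lemma sum_first_active_prob_le_1:
  assumes "u \<in> offline G"
  shows "(\<Sum>v\<in>online G. measure_pmf.expectation (vertex_string state_law v T)
    (first_active_prob state_law (u, v))) \<le> 1"
  using sum_add_prob_le_1[of u] assms
  by (simp add: expectation_add_prob_eq edges_def cong: sum.cong)

end

end

section \<open>The configuration LP bounds the offline optimum\<close>

lemma subseq_imp_mset_subset: "subseq xs ys \<Longrightarrow> mset xs \<subseteq># mset ys"
  by (induction rule: list_emb.induct) (auto simp: subseteq_mset_def le_SucI)

text \<open>Closure is given for contiguous substrings and for permutations. Permuting
  \<open>es\<close> so that the entries of \<open>fs\<close> come first turns the subsequence into a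
  prefix.\<close>

lemma downward_closed_subseq:
  assumes "downward_closed C" "es \<in> C" "subseq fs es"
  shows "fs \<in> C"
proof -
  obtain gs where gs: "mset gs = mset es - mset fs" using ex_mset by blast
  have "mset (fs @ gs) = mset es"
    using subseq_imp_mset_subset[OF assms(3)] gs by simp
  then have "fs @ gs \<in> C" using assms(1,2) unfolding downward_closed_def by blast
  moreover have "sublist fs (fs @ gs)" by simp
  ultimately show ?thesis using assms(1) unfolding downward_closed_def by blast
qed

lemma stochastic_graph_probing_graph: "stochastic_graph G \<Longrightarrow> probing_graph G"
  by unfold_locales (auto simp: stochastic_graph_def intro: downward_closed_subseq)

lemma subseq_mapE:
  assumes "subseq fs (map g es)"
  obtains es' where "subseq es' es" "fs = map g es'"
  using assms by (auto simp: subseq_conv_nths nths_map)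

locale known_id_input =
  fixes H :: "('u, 'b) sgraph" and n :: nat and D :: "nat \<Rightarrow> 'b pmf"
  assumes stochastic: "stochastic_graph H"
    and types: "\<And>i. i \<in> {1..n} \<Longrightarrow> set_pmf (D i) \<subseteq> online H"
begin

sublocale H: probing_graph H
  by (rule stochastic_graph_probing_graph[OF stochastic])

abbreviation "G \<equiv> inst_graph H n"

lemma inst_graph_simps [simp]:
  "offline (G \<tau>) = offline H" "online (G \<tau>) = {1..n}"
  "wt (G \<tau>) (u, i) = wt H (u, \<tau> i)" "pr (G \<tau>) (u, i) = pr H (u, \<tau> i)"
  "constr (G \<tau>) i = copy_string i ` constr H (\<tau> i)"
  by (simp_all add: inst_graph_def)

text \<open>Copying forgets the type, so it is injective only within one type, where all second
  components agree.\<close>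

lemma inj_on_copy_string:
  assumes "b \<in> online H"
  shows "inj_on (copy_string i) (constr H b)"
proof -
  have "\<Union> (set ` constr H b) \<subseteq> offline H \<times> {b}"
    using H.constrD(3)[OF assms] by blast
  moreover have "inj_on (\<lambda>e. (fst e, i)) (offline H \<times> {b})"
    by (auto simp: inj_on_def)
  ultimately show ?thesis
    unfolding copy_string_def by (intro inj_on_mapI) (rule inj_on_subset)
qed

lemma probing_graph_inst:
  assumes \<tau>: "\<And>i. i \<in> {1..n} \<Longrightarrow> \<tau> i \<in> online H"
  shows "probing_graph (G \<tau>)"
proof
  show "finite (offline (G \<tau>))" "finite (online (G \<tau>))" by (simp_all add: H.finite_offline)
  show "0 \<le> pr (G \<tau>) e \<and> pr (G \<tau>) e \<le> 1" if "e \<in> edges (G \<tau>)" for e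
    using that \<tau> by (cases e) (auto simp: edges_def intro!: H.pr_range[unfolded edges_def])
  fix i assume i: "i \<in> online (G \<tau>)"
  then have b: "\<tau> i \<in> online H" using \<tau> by simp
  show "constr (G \<tau>) i \<subseteq> strings (incident (G \<tau>) i)"
  proof
    fix es' assume "es' \<in> constr (G \<tau>) i"
    then obtain es where es: "es \<in> constr H (\<tau> i)" "es' = copy_string i es" by auto
    have "inj_on (\<lambda>e. (fst e, i)) (set es)"
      using H.constrD(3)[OF b es(1)] by (auto simp: inj_on_def)
    then show "es' \<in> strings (incident (G \<tau>) i)"
      using i H.constrD[OF b es(1)] unfolding es(2)
      by (auto simp: strings_def incident_def edges_def copy_string_def distinct_map)
  qed
  show "fs \<in> constr (G \<tau>) i" if es': "es' \<in> constr (G \<tau>) i" and "subseq fs es'" for es' fs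
  proof -
    obtain es where es: "es \<in> constr H (\<tau> i)" "es' = copy_string i es" using es' by auto
    with \<open>subseq fs es'\<close> obtain gs where "subseq gs es" "fs = copy_string i gs"
      unfolding copy_string_def by (auto elim: subseq_mapE)
    then show ?thesis using H.constr_subseq[OF b es(1)] by auto
  qed
qed

abbreviation "H_law \<equiv> \<lambda>e. bernoulli_pmf (pr H e)"
abbreviation "G_law \<tau> \<equiv> \<lambda>e. bernoulli_pmf (pr (G \<tau>) e)"

lemma first_active_prob_copy_string:
  assumes "set es \<subseteq> A \<times> {\<tau> i}"
  shows "first_active_prob (G_law \<tau>) (u, i) (copy_string i es) = first_active_prob H_law (u, \<tau> i) es"
  using assms by (induction es) (simp_all add: copy_string_def, auto)

lemma string_val_copy_string:
  assumes \<tau>: "\<And>i. i \<in> {1..n} \<Longrightarrow> \<tau> i \<in> online H" and i: "i \<in> {1..n}" and es: "es \<in> constr H (\<tau> i)"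
  shows "string_val (G \<tau>) (copy_string i es) = string_val H es"
proof -
  interpret G: probing_graph "G \<tau>" by (rule probing_graph_inst[OF \<tau>])
  have "string_val (G \<tau>) (copy_string i es) =
      (\<Sum>u\<in>offline (G \<tau>). wt (G \<tau>) (u, i) * first_active_prob (G_law \<tau>) (u, i) (copy_string i es))"
    by (rule G.string_val_constr) (use i es in auto)
  also have "\<dots> = (\<Sum>u\<in>offline H. wt H (u, \<tau> i) * first_active_prob H_law (u, \<tau> i) es)"
    using H.constrD(3)[OF \<tau>[OF i] es]
    by (intro sum.cong) (auto simp: first_active_prob_copy_string)
  also have "\<dots> = string_val H es"
    by (rule H.string_val_constr[OF \<tau>[OF i] es, symmetric])
  finally show ?thesis .
qed

lemma type_profile_range: "\<tau> \<in> set_pmf (type_profile n D) \<Longrightarrow> i \<in> {1..n} \<Longrightarrow> \<tau> i \<in> online H"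
  using types[of i] by (auto simp: type_profile_def set_Pi_pmf PiE_dflt_def)

lemma finite_type_profile: "finite (set_pmf (type_profile n D))"
  unfolding type_profile_def
  by (simp add: set_Pi_pmf, rule finite_PiE_dflt)
     (auto intro: finite_subset[OF types H.finite_online])

lemma integrable_type_profile:
  fixes f :: "_ \<Rightarrow> real"
  shows "integrable (measure_pmf (type_profile n D)) f"
  by (rule integrable_measure_pmf_finite[OF finite_type_profile])

lemma expectation_type:
  assumes "i \<in> {1..n}"
  shows "measure_pmf.expectation (type_profile n D) (\<lambda>\<tau>. f (\<tau> i) :: real) = measure_pmf.expectation (D i) f"
  unfolding type_profile_def by (rule expectation_Pi_pmf_component) (use assms in auto)

lemma expectation_type_profile_cong:
  fixes f g :: "_ \<Rightarrow> real"
  assumes "\<And>\<tau>. \<tau> \<in> set_pmf (type_profile n D) \<Longrightarrow> f \<tau> = g \<tau>"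
  shows "measure_pmf.expectation (type_profile n D) f = measure_pmf.expectation (type_profile n D) g"
  using assms by (intro integral_cong_AE) (auto simp: AE_measure_pmf_iff)

lemma sum_first_active_prob_eq:
  assumes b: "b \<in> online H"
  shows "(\<Sum>es\<in>constr H b. first_active_prob H_law (u, b) es * f es) =
    (\<Sum>es\<in>{es \<in> constr H b. (u, b) \<in> set es}.
      pr H (u, b) * none_active H (before es (u, b)) * f es)"
  using H.finite_constr[OF b]
  by (intro sum.mono_neutral_cong_right) (auto simp: H.first_active_prob_constr[OF b])

section \<open>The LP solution induced by one offline algorithm per type profile\<close>

context
  fixes Tr :: "(nat \<Rightarrow> 'b) \<Rightarrow> ('u \<times> nat) probing_tree"
  assumes Tr: "\<And>\<tau>. \<tau> \<in> set_pmf (type_profile n D) \<Longrightarrow> offline_probing_algorithm (G \<tau>) (Tr \<tau>)"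
begin

definition "tree_string \<tau> i = vertex_string (G_law \<tau>) i (Tr \<tau>)"

text \<open>The joint probability that vertex \<open>i\<close> has type \<open>b\<close> and draws
  the copy of \<open>es\<close>. It is not conditioned on the type, so the entries for
  \<open>b\<close> sum to \<open>pmf (D i) b\<close>. The tree may depend on the whole profile, as
  the offline algorithm sees all types; the types of the other vertices are averaged out.\<close>

definition tree_lp :: "('u, 'b) lp_vars" where
  "tree_lp i es b = measure_pmf.expectation (type_profile n D)
     (\<lambda>\<tau>. of_bool (\<tau> i = b) * pmf (tree_string \<tau> i) (copy_string i es))"

lemma expectation_tree_string:
  fixes F :: "_ \<Rightarrow> real"
  assumes \<tau>: "\<tau> \<in> set_pmf (type_profile n D)" and i: "i \<in> {1..n}"
  shows "measure_pmf.expectation (tree_string \<tau> i) F =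
    (\<Sum>es\<in>constr H (\<tau> i). F (copy_string i es) * pmf (tree_string \<tau> i) (copy_string i es))"
proof -
  interpret G: probing_graph "G \<tau>" by (rule probing_graph_inst[OF type_profile_range[OF \<tau>]])
  have "set_pmf (tree_string \<tau> i) \<subseteq> constr (G \<tau>) i"
    unfolding tree_string_def by (rule G.vertex_string_in_constr[OF Tr[OF \<tau>]]) (use i in simp)
  then have "measure_pmf.expectation (tree_string \<tau> i) F =
      (\<Sum>es\<in>constr (G \<tau>) i. F es * pmf (tree_string \<tau> i) es)"
    by (intro integral_measure_pmf_real G.finite_constr) (use i in auto)
  also have "\<dots> = (\<Sum>es\<in>constr H (\<tau> i). F (copy_string i es) * pmf (tree_string \<tau> i) (copy_string i es))"
    using inj_on_copy_string[OF type_profile_range[OF \<tau> i]] by (simp add: sum.reindex)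
  finally show ?thesis .
qed

text \<open>Used twice: with \<open>F\<close> the string value for the objective, and with
  \<open>F\<close> the first-active probability for the capacity constraints.\<close>

lemma sum_tree_lp:
  assumes i: "i \<in> {1..n}"
  shows "(\<Sum>b\<in>online H. \<Sum>es\<in>constr H b. F es b * tree_lp i es b) =
    measure_pmf.expectation (type_profile n D) (\<lambda>\<tau>.
      \<Sum>es\<in>constr H (\<tau> i). F es (\<tau> i) * pmf (tree_string \<tau> i) (copy_string i es))"
proof -
  have "(\<Sum>b\<in>online H. \<Sum>es\<in>constr H b. F es b * tree_lp i es b) =
    measure_pmf.expectation (type_profile n D) (\<lambda>\<tau>. \<Sum>b\<in>online H. \<Sum>es\<in>constr H b.
      F es b * (of_bool (\<tau> i = b) * pmf (tree_string \<tau> i) (copy_string i es)))"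
    unfolding tree_lp_def
    by (simp add: Bochner_Integration.integral_sum integrable_type_profile del: of_bool_eq_iff)
  also have "\<dots> = measure_pmf.expectation (type_profile n D) (\<lambda>\<tau>.
      \<Sum>es\<in>constr H (\<tau> i). F es (\<tau> i) * pmf (tree_string \<tau> i) (copy_string i es))"
  proof (intro integral_cong_AE)
    show "AE \<tau> in measure_pmf (type_profile n D).
       (\<Sum>b\<in>online H. \<Sum>es\<in>constr H b.
          F es b * (of_bool (\<tau> i = b) * pmf (tree_string \<tau> i) (copy_string i es))) =
       (\<Sum>es\<in>constr H (\<tau> i). F es (\<tau> i) * pmf (tree_string \<tau> i) (copy_string i es))"
      unfolding AE_measure_pmf_iff
    proof
      fix \<tau> assume "\<tau> \<in> set_pmf (type_profile n D)"
      then have "\<tau> i \<in> online H" using i by (rule type_profile_range)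
      have "(\<Sum>b\<in>online H. \<Sum>es\<in>constr H b.
          F es b * (of_bool (\<tau> i = b) * pmf (tree_string \<tau> i) (copy_string i es))) =
        (\<Sum>b\<in>online H. if b = \<tau> i then
          (\<Sum>es\<in>constr H b. F es b * pmf (tree_string \<tau> i) (copy_string i es)) else 0)"
        by (intro sum.cong) auto
      also have "\<dots> = (\<Sum>es\<in>constr H (\<tau> i). F es (\<tau> i) * pmf (tree_string \<tau> i) (copy_string i es))"
        using \<open>\<tau> i \<in> online H\<close> H.finite_online by simp
      finally show "(\<Sum>b\<in>online H. \<Sum>es\<in>constr H b.
          F es b * (of_bool (\<tau> i = b) * pmf (tree_string \<tau> i) (copy_string i es))) =
       (\<Sum>es\<in>constr H (\<tau> i). F es (\<tau> i) * pmf (tree_string \<tau> i) (copy_string i es))" .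
    qed
  qed auto
  finally show ?thesis .
qed

lemma lp_value_tree_lp:
  "lp_config_id_value H n tree_lp =
     measure_pmf.expectation (type_profile n D) (\<lambda>\<tau>. expected_weight (G \<tau>) (Tr \<tau>))"
proof -
  have "lp_config_id_value H n tree_lp = measure_pmf.expectation (type_profile n D) (\<lambda>\<tau>.
      \<Sum>i\<in>{1..n}. \<Sum>es\<in>constr H (\<tau> i). string_val H es * pmf (tree_string \<tau> i) (copy_string i es))"
    unfolding lp_config_id_value_def
    by (subst Bochner_Integration.integral_sum) (auto intro!: integrable_type_profile sum.cong sum_tree_lp)
  also have "\<dots> = measure_pmf.expectation (type_profile n D) (\<lambda>\<tau>. expected_weight (G \<tau>) (Tr \<tau>))"
  proof (rule expectation_type_profile_cong)
    fix \<tau> assume \<tau>: "\<tau> \<in> set_pmf (type_profile n D)"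
    interpret G: probing_graph "G \<tau>" by (rule probing_graph_inst[OF type_profile_range[OF \<tau>]])
    have "expected_weight (G \<tau>) (Tr \<tau>) =
        (\<Sum>i\<in>{1..n}. measure_pmf.expectation (tree_string \<tau> i) (string_val (G \<tau>)))"
      using G.expected_weight_eq_string_val[OF Tr[OF \<tau>]] by (simp add: tree_string_def)
    moreover have "measure_pmf.expectation (tree_string \<tau> i) (string_val (G \<tau>)) =
        (\<Sum>es\<in>constr H (\<tau> i). string_val H es * pmf (tree_string \<tau> i) (copy_string i es))"
      if i: "i \<in> {1..n}" for i
      unfolding expectation_tree_string[OF \<tau> i]
      by (intro sum.cong refl arg_cong2[where f = "(*)"] string_val_copy_string)
         (use type_profile_range[OF \<tau>] i in auto)
    ultimately show "(\<Sum>i\<in>{1..n}. \<Sum>es\<in>constr H (\<tau> i).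
        string_val H es * pmf (tree_string \<tau> i) (copy_string i es)) = expected_weight (G \<tau>) (Tr \<tau>)"
      by simp
  qed
  finally show ?thesis .
qed

text \<open>Capacity holds for each profile separately by the matching property and is then
  averaged. The mass constraint says that, given the type, the drawn string is some string of that
  type with total probability 1.\<close>

lemma tree_lp_feasible: "lp_config_id_feasible H n D tree_lp"
  unfolding lp_config_id_feasible_def
proof (intro conjI ballI)
  show "0 \<le> tree_lp i es b" for i es b
    unfolding tree_lp_def by (intro integral_nonneg_AE) auto
next
  fix u assume u: "u \<in> offline H"
  have "(\<Sum>i\<in>{1..n}. \<Sum>b\<in>online H. \<Sum>es\<in>{es \<in> constr H b. (u, b) \<in> set es}.
      pr H (u, b) * none_active H (before es (u, b)) * tree_lp i es b) =
    measure_pmf.expectation (type_profile n D) (\<lambda>\<tau>.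
      \<Sum>i\<in>{1..n}. \<Sum>es\<in>constr H (\<tau> i). first_active_prob H_law (u, \<tau> i) es *
        pmf (tree_string \<tau> i) (copy_string i es))"
  proof (subst Bochner_Integration.integral_sum, rule integrable_type_profile, rule sum.cong[OF refl])
    fix i assume i: "i \<in> {1..n}"
    show "(\<Sum>b\<in>online H. \<Sum>es\<in>{es \<in> constr H b. (u, b) \<in> set es}.
        pr H (u, b) * none_active H (before es (u, b)) * tree_lp i es b) =
      measure_pmf.expectation (type_profile n D) (\<lambda>\<tau>.
        \<Sum>es\<in>constr H (\<tau> i). first_active_prob H_law (u, \<tau> i) es *
          pmf (tree_string \<tau> i) (copy_string i es))"
      by (rule trans[OF _ sum_tree_lp[OF i, of "\<lambda>es b. first_active_prob H_law (u, b) es"]])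
         (intro sum.cong refl sum_first_active_prob_eq[symmetric])
  qed
  also have "\<dots> \<le> 1"
  proof (rule measure_pmf.integral_le_const[OF integrable_type_profile], unfold AE_measure_pmf_iff, rule ballI)
    fix \<tau> assume \<tau>: "\<tau> \<in> set_pmf (type_profile n D)"
    interpret G: probing_graph "G \<tau>" by (rule probing_graph_inst[OF type_profile_range[OF \<tau>]])
    have "(\<Sum>es\<in>constr H (\<tau> i). first_active_prob H_law (u, \<tau> i) es *
        pmf (tree_string \<tau> i) (copy_string i es)) =
      measure_pmf.expectation (tree_string \<tau> i) (first_active_prob (G_law \<tau>) (u, i))"
      if i: "i \<in> {1..n}" for i
      unfolding expectation_tree_string[OF \<tau> i]
      by (intro sum.cong refl arg_cong2[where f = "(*)"] first_active_prob_copy_string[symmetric])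
         (rule H.constrD(3)[OF type_profile_range[OF \<tau> i]])
    then show "(\<Sum>i\<in>{1..n}. \<Sum>es\<in>constr H (\<tau> i). first_active_prob H_law (u, \<tau> i) es *
        pmf (tree_string \<tau> i) (copy_string i es)) \<le> 1"
      using G.sum_first_active_prob_le_1[OF Tr[OF \<tau>], of u] u by (simp add: tree_string_def)
  qed
  finally show "(\<Sum>i\<in>{1..n}. \<Sum>b\<in>online H. \<Sum>es\<in>{es \<in> constr H b. (u, b) \<in> set es}.
      pr H (u, b) * none_active H (before es (u, b)) * tree_lp i es b) \<le> 1" .
next
  fix b i assume b: "b \<in> online H" and i: "i \<in> {1..n}"
  have "(\<Sum>es\<in>constr H b. tree_lp i es b) = measure_pmf.expectation (type_profile n D)
      (\<lambda>\<tau>. of_bool (\<tau> i = b) * (\<Sum>es\<in>constr H b. pmf (tree_string \<tau> i) (copy_string i es)))"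
    unfolding tree_lp_def sum_distrib_left
    by (rule Bochner_Integration.integral_sum[symmetric]) (rule integrable_type_profile)
  also have "\<dots> = measure_pmf.expectation (type_profile n D) (\<lambda>\<tau>. of_bool (\<tau> i = b))"
  proof (rule expectation_type_profile_cong)
    fix \<tau> assume \<tau>: "\<tau> \<in> set_pmf (type_profile n D)"
    show "of_bool (\<tau> i = b) * (\<Sum>es\<in>constr H b. pmf (tree_string \<tau> i) (copy_string i es)) = of_bool (\<tau> i = b)"
      using expectation_tree_string[OF \<tau> i, of "\<lambda>_. 1"] by auto
  qed
  also have "\<dots> = measure_pmf.expectation (D i) (\<lambda>a. of_bool (a = b))"
    by (rule expectation_type[OF i])
  also have "\<dots> = pmf (D i) b"
    by (subst integral_measure_pmf_real[of "{b}"]) (auto split: if_splits)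
  finally show "(\<Sum>es\<in>constr H b. tree_lp i es b) = pmf (D i) b" .
qed

end

theorem OPT_id_le_lp_value:
  assumes ne: "\<And>b. b \<in> online H \<Longrightarrow> constr H b \<noteq> {}"
    and opt: "\<And>y. lp_config_id_feasible H n D y \<Longrightarrow> lp_config_id_value H n y \<le> V"
  shows "OPT_id H n D \<le> V"
proof (rule field_le_epsilon)
  fix \<epsilon> :: real assume "\<epsilon> > 0"
  have "\<exists>T. offline_probing_algorithm (G \<tau>) T \<and> OPT (G \<tau>) - \<epsilon> < expected_weight (G \<tau>) T"
    if \<tau>: "\<tau> \<in> set_pmf (type_profile n D)" for \<tau>
  proof -
    interpret G: probing_graph "G \<tau>" by (rule probing_graph_inst[OF type_profile_range[OF \<tau>]])
    let ?S = "{T. offline_probing_algorithm (G \<tau>) T}"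
    \<comment> \<open>A nonempty constraint contains the empty string, so the tree that probes
      nothing is valid and the supremum ranges over a nonempty set.\<close>
    have "[] \<in> constr (G \<tau>) i" if "i \<in> {1..n}" for i
      using ne[OF type_profile_range[OF \<tau> that]] G.constr_subseq[of i _ "[]"] that by fastforce
    then have "Halt \<in> ?S"
      by (auto simp: offline_probing_algorithm_def is_matching_def)
    moreover have "bdd_above (expected_weight (G \<tau>) ` ?S)"
      using G.expected_weight_le by (auto simp: bdd_above_def)
    ultimately have "\<exists>T\<in>?S. OPT (G \<tau>) - \<epsilon> < expected_weight (G \<tau>) T"
      unfolding OPT_def using \<open>\<epsilon> > 0\<close>
      by (subst less_cSUP_iff[symmetric]) auto
    then show ?thesis by auto
  qed
  then obtain Tr where Tr: "\<And>\<tau>. \<tau> \<in> set_pmf (type_profile n D) \<Longrightarrow> offline_probing_algorithm (G \<tau>) (Tr \<tau>)"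
    and less: "\<And>\<tau>. \<tau> \<in> set_pmf (type_profile n D) \<Longrightarrow> OPT (G \<tau>) - \<epsilon> < expected_weight (G \<tau>) (Tr \<tau>)"
    by metis
  have "OPT_id H n D \<le> measure_pmf.expectation (type_profile n D) (\<lambda>\<tau>. expected_weight (G \<tau>) (Tr \<tau>) + \<epsilon>)"
    unfolding OPT_id_def
    by (intro integral_mono_AE integrable_type_profile)
       (auto simp: AE_measure_pmf_iff dest!: less)
  also have "\<dots> = measure_pmf.expectation (type_profile n D) (\<lambda>\<tau>. expected_weight (G \<tau>) (Tr \<tau>)) + \<epsilon>"
    by (simp add: integrable_type_profile)
  also have "\<dots> = lp_config_id_value H n (tree_lp Tr) + \<epsilon>"
    using lp_value_tree_lp[of Tr] Tr by simp
  also have "\<dots> \<le> V + \<epsilon>"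
    using opt[OF tree_lp_feasible[of Tr]] Tr by simp
  finally show "OPT_id H n D \<le> V + \<epsilon>" .
qed

end

section \<open>Analysis of the online algorithm\<close>

text \<open>Ties the operational VertexProbe to the LP coefficients. The head and the rest of the
  string read disjoint coordinates because the string is distinct.\<close>

lemma expectation_find:
  assumes E: "finite E" and "distinct es" "set es \<subseteq> E"
  shows "measure_pmf.expectation (Pi_pmf E False sp) (\<lambda>st. of_bool (find st es = Some f)) =
    first_active_prob sp f es"
  using assms(2,3)
proof (induction es)
  case (Cons e es)
  let ?P = "Pi_pmf E False sp"
  have e: "e \<in> E" "e \<notin> set es" using Cons.prems by auto
  show ?case
  proof (cases "e = f")
    case True
    have "find st es \<noteq> Some f" for st
      using e True by (auto simp: find_Some_iff)
    then have "(\<lambda>st. of_bool (find st (e # es) = Some f) :: real) = (\<lambda>st. of_bool (st e))"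
      using True by auto
    then show ?thesis
      using True expectation_Pi_pmf_component[OF E e(1), where g = of_bool and d = False and p = sp]
      by (simp add: expectation_bool_pmf)
  next
    case False
    have dep: "depends_on {e} (\<lambda>st. of_bool (\<not> st e) :: real)"
      "depends_on (set es) (\<lambda>st. of_bool (find st es = Some f) :: real)"
      by (auto simp: depends_on_def cong: find_cong)
    have "(\<lambda>st. of_bool (find st (e # es) = Some f) :: real) =
        (\<lambda>st. of_bool (\<not> st e) * of_bool (find st es = Some f))"
      using False by auto
    then have "measure_pmf.expectation ?P (\<lambda>st. of_bool (find st (e # es) = Some f) :: real) =
        measure_pmf.expectation ?P (\<lambda>st. of_bool (\<not> st e) * of_bool (find st es = Some f))"
      by (rule arg_cong)
    also have "\<dots> = measure_pmf.expectation ?P (\<lambda>st. of_bool (\<not> st e)) *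
        measure_pmf.expectation ?P (\<lambda>st. of_bool (find st es = Some f))"
      by (rule expectation_Pi_pmf_mult[OF E _ dep(1) _ dep(2), where B = 1 and C = 1]) (use e in auto)
    also have "measure_pmf.expectation ?P (\<lambda>st. of_bool (\<not> st e)) = pmf (sp e) False"
      using expectation_Pi_pmf_component[OF E e(1), where g = "\<lambda>b. of_bool (\<not> b)" and d = False and p = sp]
      by (simp add: expectation_bool_pmf)
    finally show ?thesis using Cons False by simp
  qed
qed simp

locale aom_id_input = known_id_input H n D
  for H :: "('u, 'b) sgraph" and n :: nat and D :: "nat \<Rightarrow> 'b pmf" +
  fixes x :: "('u, 'b) lp_vars" and \<pi> :: "nat \<Rightarrow> nat"
  assumes pos: "\<And>i b. i \<in> {1..n} \<Longrightarrow> b \<in> online H \<Longrightarrow> pmf (D i) b > 0"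
    and perm: "bij_betw \<pi> {1..n} {1..n}"
    and feasible: "lp_config_id_feasible H n D x"
begin

lemma x_nonneg: "i \<in> {1..n} \<Longrightarrow> b \<in> online H \<Longrightarrow> es \<in> constr H b \<Longrightarrow> 0 \<le> x i es b"
  and sum_x: "i \<in> {1..n} \<Longrightarrow> b \<in> online H \<Longrightarrow> (\<Sum>es\<in>constr H b. x i es b) = pmf (D i) b"
  using feasible by (simp_all add: lp_config_id_feasible_def)

text \<open>Discharges the obligation behind \<open>embed_pmf\<close>: by the mass constraint and
  positivity of \<open>pmf (D i) a\<close>, the quotients sum to 1.\<close>

lemma pmf_draw_string:
  assumes "i \<in> {1..n}" "a \<in> online H"
  shows "pmf (draw_string H D x i a) es = (if es \<in> constr H a then x i es a / pmf (D i) a else 0)"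
  unfolding draw_string_def
proof (rule pmf_embed_pmf)
  let ?f = "\<lambda>es. if es \<in> constr H a then x i es a / pmf (D i) a else 0"
  show "0 \<le> ?f es" for es
    using x_nonneg[OF assms] by simp
  have "(\<integral>\<^sup>+ es. ennreal (?f es) \<partial>count_space UNIV) = (\<Sum>es\<in>constr H a. ennreal (?f es))"
    using H.finite_constr[OF assms(2)] by (intro nn_integral_count_space') auto
  also have "\<dots> = ennreal (\<Sum>es\<in>constr H a. ?f es)"
    using x_nonneg[OF assms] by (intro sum_ennreal) auto
  also have "(\<Sum>es\<in>constr H a. ?f es) = 1"
    using sum_x[OF assms] pos[OF assms] by (simp add: sum_divide_distrib[symmetric])
  finally show "(\<integral>\<^sup>+ es. ennreal (?f es) \<partial>count_space UNIV) = 1" by simp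
qed

lemma set_draw_string:
  assumes "i \<in> {1..n}" "a \<in> online H"
  shows "set_pmf (draw_string H D x i a) \<subseteq> constr H a"
  by (auto simp: set_pmf_iff pmf_draw_string[OF assms] split: if_splits)

lemma set_vertex_probe:
  assumes "i \<in> {1..n}" "a \<in> online H" "Some e \<in> set_pmf (vertex_probe H D x st i a)"
  shows "e \<in> offline H \<times> {i}"
proof -
  obtain es where es: "es \<in> constr H a" "find st (copy_string i es) = Some e"
    using assms(3) set_draw_string[OF assms(1,2)] by (auto simp: vertex_probe_def)
  then have "e \<in> set (copy_string i es)" by (auto simp: find_Some_iff)
  then show ?thesis using H.constrD(3)[OF assms(2) es(1)] by (auto simp: copy_string_def)
qed

lemma vertex_probe_cong:
  "(\<And>u. st (u, i) = st' (u, i)) \<Longrightarrow> vertex_probe H D x st i a = vertex_probe H D x st' i a"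
  unfolding vertex_probe_def
  by (intro map_pmf_cong refl find_cong) (auto simp: copy_string_def)

abbreviation "steps \<equiv> aom_id_steps H D x \<pi>"

text \<open>The first \<open>t\<close> rounds read only the types and edges of the vertices that
  have arrived. This is the source of their independence from the next arrival.\<close>

lemma steps_cong:
  assumes "\<And>j. j \<in> {1..t} \<Longrightarrow> \<tau> (\<pi> j) = \<tau>' (\<pi> j)"
    and "\<And>u j. j \<in> {1..t} \<Longrightarrow> st (u, \<pi> j) = st' (u, \<pi> j)"
  shows "steps \<tau> st t = steps \<tau>' st' t"
  using assms
proof (induction t)
  case (Suc t)
  have "steps \<tau> st t = steps \<tau>' st' t" by (rule Suc.IH) (use Suc.prems in auto)
  moreover have "vertex_probe H D x st (\<pi> (Suc t)) (\<tau> (\<pi> (Suc t))) =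
      vertex_probe H D x st' (\<pi> (Suc t)) (\<tau>' (\<pi> (Suc t)))"
    using Suc.prems by (simp add: vertex_probe_cong[of st _ st'])
  ultimately show ?case by simp
qed simp

lemma perm_range: "j \<in> {1..n} \<Longrightarrow> \<pi> j \<in> {1..n}"
  using perm by (rule bij_betwE[THEN bspec])

lemma perm_notin: "t < n \<Longrightarrow> \<pi> (Suc t) \<notin> \<pi> ` {1..t}"
  using bij_betw_imp_inj_on[OF perm] by (auto dest!: inj_onD)

lemma set_steps:
  assumes "\<forall>i\<in>{1..n}. \<tau> i \<in> online H" "t \<le> n" "M \<in> set_pmf (steps \<tau> st t)"
  shows "M \<subseteq> offline H \<times> {1..n} \<and> inj_on fst M"
  using assms(2,3)
proof (induction t arbitrary: M)
  case (Suc t)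
  have i: "\<pi> (Suc t) \<in> {1..n}" using Suc.prems by (intro perm_range) auto
  from Suc.prems(2) obtain M' out where M': "M' \<in> set_pmf (steps \<tau> st t)"
    and out: "out \<in> set_pmf (vertex_probe H D x st (\<pi> (Suc t)) (\<tau> (\<pi> (Suc t))))"
    and M: "M = M' \<or> (\<exists>e. out = Some e \<and> fst e \<notin> fst ` M' \<and> M = insert e M')"
    by (auto split: option.splits if_splits) blast+
  have IH: "M' \<subseteq> offline H \<times> {1..n} \<and> inj_on fst M'"
    using Suc.IH[OF _ M'] Suc.prems by simp
  from M show ?case
  proof
    assume "\<exists>e. out = Some e \<and> fst e \<notin> fst ` M' \<and> M = insert e M'"
    then obtain e where e: "out = Some e" "fst e \<notin> fst ` M'" "M = insert e M'" by blast
    have "e \<in> offline H \<times> {\<pi> (Suc t)}"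
      using set_vertex_probe[OF i bspec[OF assms(1) i]] out e(1) by simp
    then show ?thesis using IH e i by auto
  qed (use IH in simp)
qed simp

lemma finite_steps:
  assumes "\<forall>i\<in>{1..n}. \<tau> i \<in> online H" "t \<le> n"
  shows "finite (set_pmf (steps \<tau> st t))"
proof (rule finite_subset)
  show "set_pmf (steps \<tau> st t) \<subseteq> Pow (offline H \<times> {1..n})"
    using set_steps[OF assms] by blast
qed (simp add: H.finite_offline)

section \<open>Evolution of the matching and independence of the next arrival\<close>

abbreviation "accept u t \<equiv> accept_prob H x \<pi> u t"

text \<open>Arbitrary weights let one recursion do two jobs: edge weights give the weight of the
  matching, and the indicator of one \<open>u\<close> tells whether \<open>u\<close> is
  matched.\<close>

definition matching_value :: "('u \<Rightarrow> 'b \<Rightarrow> real) \<Rightarrow> (nat \<Rightarrow> 'b) \<Rightarrow> ('u \<times> nat) set \<Rightarrow> real" where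
  "matching_value h \<tau> M = (\<Sum>e\<in>M. h (fst e) (\<tau> (snd e)))"

definition free_prob :: "(nat \<Rightarrow> 'b) \<Rightarrow> nat \<Rightarrow> 'u \<Rightarrow> ('u \<times> nat \<Rightarrow> bool) \<Rightarrow> real" where
  "free_prob \<tau> t u st = measure_pmf.expectation (steps \<tau> st t) (\<lambda>M. of_bool (u \<notin> fst ` M))"

definition output_prob :: "(nat \<Rightarrow> 'b) \<Rightarrow> nat \<Rightarrow> 'u \<Rightarrow> ('u \<times> nat \<Rightarrow> bool) \<Rightarrow> real" where
  "output_prob \<tau> i u st = pmf (vertex_probe H D x st i (\<tau> i)) (Some (u, i))"

text \<open>With types and states fixed, the only randomness left is the coins of the algorithm.
  Those of the new round are fresh, so the free and output probabilities multiply.\<close>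

lemma expectation_step:
  assumes \<tau>: "\<forall>i\<in>{1..n}. \<tau> i \<in> online H" and t: "t < n"
    and q: "\<And>u. u \<in> offline H \<Longrightarrow> 0 \<le> accept u (Suc t) \<and> accept u (Suc t) \<le> 1"
  defines "i \<equiv> \<pi> (Suc t)"
  shows "measure_pmf.expectation (steps \<tau> st (Suc t)) (matching_value h \<tau>) =
    measure_pmf.expectation (steps \<tau> st t) (matching_value h \<tau>) +
    (\<Sum>u\<in>offline H. accept u (Suc t) * h u (\<tau> i) * (free_prob \<tau> t u st * output_prob \<tau> i u st))"
proof -
  let ?vp = "vertex_probe H D x st i (\<tau> i)"
  have i: "i \<in> {1..n}" unfolding i_def using t by (intro perm_range) auto
  define K where "K M out = (case out of
         None \<Rightarrow> return_pmf M
       | Some e \<Rightarrow>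
           if fst e \<in> fst ` M then return_pmf M
           else map_pmf (\<lambda>add. if add then insert e M else M)
                  (bernoulli_pmf (accept (fst e) (Suc t))))"
    for M and out :: "('u \<times> nat) option"
  define L where "L M = bind_pmf ?vp (K M)" for M
  have steps: "steps \<tau> st (Suc t) = bind_pmf (steps \<tau> st t) L"
    unfolding aom_id_steps.simps L_def[abs_def] i_def[symmetric]
    by (intro bind_pmf_cong refl) (simp add: K_def)
  have fin: "finite (set_pmf (bind_pmf (steps \<tau> st t) L))"
    unfolding steps[symmetric] by (rule finite_steps[OF \<tau>]) (use t in auto)
  note fin_steps = finite_steps[OF \<tau> less_imp_le[OF t], of st]
  have K: "measure_pmf.expectation (K M out) (matching_value h \<tau>) = matching_value h \<tau> M +
      (case out of None \<Rightarrow> 0 | Some e \<Rightarrow> of_bool (fst e \<notin> fst ` M) * accept (fst e) (Suc t) * h (fst e) (\<tau> i))"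
    if M: "M \<in> set_pmf (steps \<tau> st t)" and out: "out \<in> set_pmf ?vp" for M out
  proof (cases "\<exists>e. out = Some e \<and> fst e \<notin> fst ` M")
    case True
    then obtain e where e: "out = Some e" "fst e \<notin> fst ` M" by blast
    then have e': "e \<in> offline H \<times> {i}" using set_vertex_probe[OF i bspec[OF \<tau> i]] out by simp
    have "finite M"
      using set_steps[OF \<tau> less_imp_le[OF t] M] H.finite_offline by (auto intro: finite_subset)
    moreover have "e \<notin> M" using e by auto
    ultimately have "matching_value h \<tau> (insert e M) = matching_value h \<tau> M + h (fst e) (\<tau> i)"
      using e' by (auto simp: matching_value_def)
    moreover have "0 \<le> accept (fst e) (Suc t) \<and> accept (fst e) (Suc t) \<le> 1"
      using q e' by auto
    ultimately show ?thesis
      using e by (simp add: K_def expectation_bool_pmf algebra_simps)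
  next
    case False
    then show ?thesis by (cases out) (auto simp: K_def)
  qed
  have L: "measure_pmf.expectation (L M) (matching_value h \<tau>) = matching_value h \<tau> M +
      (\<Sum>u\<in>offline H. accept u (Suc t) * h u (\<tau> i) * (of_bool (u \<notin> fst ` M) * output_prob \<tau> i u st))"
    if M: "M \<in> set_pmf (steps \<tau> st t)" for M
  proof -
    have vp_sub: "set_pmf ?vp \<subseteq> insert None (Some ` (offline H \<times> {i}))"
    proof
      fix out assume "out \<in> set_pmf ?vp"
      then show "out \<in> insert None (Some ` (offline H \<times> {i}))"
        using set_vertex_probe[OF i bspec[OF \<tau> i]] by (cases out) auto
    qed
    then have fin_vp: "finite (set_pmf ?vp)"
      by (rule finite_subset) (simp add: H.finite_offline)
    let ?g = "\<lambda>out. case out of None \<Rightarrow> 0 | Some e \<Rightarrow>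
      of_bool (fst e \<notin> fst ` M) * accept (fst e) (Suc t) * h (fst e) (\<tau> i)"
    have "measure_pmf.expectation (L M) (matching_value h \<tau>) =
        measure_pmf.expectation ?vp (\<lambda>out. measure_pmf.expectation (K M out) (matching_value h \<tau>))"
      unfolding L_def
    proof (rule expectation_bind_pmf_finite)
      show "finite (set_pmf (bind_pmf ?vp (K M)))"
        by (rule finite_subset[OF _ fin]) (use M in \<open>auto simp: L_def\<close>)
    qed
    also have "\<dots> = measure_pmf.expectation ?vp (\<lambda>out. matching_value h \<tau> M + ?g out)"
      by (intro integral_cong_AE) (auto simp: AE_measure_pmf_iff K[OF M])
    also have "\<dots> = matching_value h \<tau> M + measure_pmf.expectation ?vp ?g"
      by (simp add: integrable_measure_pmf_finite[OF fin_vp])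
    also have "measure_pmf.expectation ?vp ?g = (\<Sum>out\<in>Some ` (\<lambda>u. (u, i)) ` offline H. ?g out * pmf ?vp out)"
      using vp_sub by (intro integral_measure_pmf_real) (auto simp: H.finite_offline split: option.splits)
    also have "\<dots> = (\<Sum>u\<in>offline H. accept u (Suc t) * h u (\<tau> i) * (of_bool (u \<notin> fst ` M) * output_prob \<tau> i u st))"
      by (subst sum.reindex, simp, subst sum.reindex) (auto simp: inj_on_def output_prob_def intro!: sum.cong)
    finally show ?thesis .
  qed
  have "measure_pmf.expectation (steps \<tau> st (Suc t)) (matching_value h \<tau>) =
      measure_pmf.expectation (steps \<tau> st t) (\<lambda>M. measure_pmf.expectation (L M) (matching_value h \<tau>))"
    unfolding steps by (rule expectation_bind_pmf_finite[OF fin])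
  also have "\<dots> = measure_pmf.expectation (steps \<tau> st t) (\<lambda>M. matching_value h \<tau> M +
      (\<Sum>u\<in>offline H. accept u (Suc t) * h u (\<tau> i) * (of_bool (u \<notin> fst ` M) * output_prob \<tau> i u st)))"
    by (intro integral_cong_AE) (auto simp: AE_measure_pmf_iff L)
  also have "\<dots> = measure_pmf.expectation (steps \<tau> st t) (matching_value h \<tau>) +
    (\<Sum>u\<in>offline H. accept u (Suc t) * h u (\<tau> i) * (free_prob \<tau> t u st * output_prob \<tau> i u st))"
    by (simp add: Bochner_Integration.integral_sum integrable_measure_pmf_finite[OF fin_steps] free_prob_def)
  finally show ?thesis .
qed

lemma edges_inst: "edges (G \<tau>) = offline H \<times> {1..n}"
  by (simp add: edges_def)

lemma valid_types: "\<tau> \<in> set_pmf (type_profile n D) \<Longrightarrow> \<forall>i\<in>{1..n}. \<tau> i \<in> online H"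
  using type_profile_range by blast

lemma edge_states_inst:
  "edge_states (G \<tau>) = Pi_pmf (offline H \<times> {1..n}) False (G_law \<tau>)"
  by (simp add: edge_states_def edges_inst)

lemma finite_edges_inst: "finite (offline H \<times> {1..n})"
  by (simp add: H.finite_offline)

lemma integrable_edge_states:
  fixes f :: "_ \<Rightarrow> real"
  shows "integrable (measure_pmf (edge_states (G \<tau>))) f"
  unfolding edge_states_inst using finite_edges_inst
  by (intro integrable_measure_pmf_finite) (auto simp: set_Pi_pmf)

lemma free_prob_bounds: "0 \<le> free_prob \<tau> t u st" "free_prob \<tau> t u st \<le> 1"
  unfolding free_prob_def
  by (auto intro!: integral_nonneg_AE measure_pmf.integral_le_const measure_pmf.integrable_const_bound[where B = 1])

lemma output_prob_bounds: "0 \<le> output_prob \<tau> i u st" "output_prob \<tau> i u st \<le> 1"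
  by (simp_all add: output_prob_def pmf_le_1)

lemma depends_on_free_prob: "depends_on (UNIV \<times> \<pi> ` {1..t}) (free_prob \<tau> t u)"
  unfolding depends_on_def
proof (intro allI impI)
  fix st st' :: "'u \<times> nat \<Rightarrow> bool" assume "\<forall>e\<in>UNIV \<times> \<pi> ` {1..t}. st e = st' e"
  then have "steps \<tau> st t = steps \<tau> st' t" by (intro steps_cong) auto
  then show "free_prob \<tau> t u st = free_prob \<tau> t u st'" by (simp add: free_prob_def)
qed

lemma depends_on_output_prob: "depends_on (UNIV \<times> {i}) (output_prob \<tau> i u)"
  unfolding depends_on_def
proof (intro allI impI)
  fix st st' :: "'u \<times> nat \<Rightarrow> bool" assume "\<forall>e\<in>UNIV \<times> {i}. st e = st' e"
  then have "vertex_probe H D x st i (\<tau> i) = vertex_probe H D x st' i (\<tau> i)"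
    by (intro vertex_probe_cong) auto
  then show "output_prob \<tau> i u st = output_prob \<tau> i u st'" by (simp add: output_prob_def)
qed

text \<open>The law of the states itself depends on the types. A function that sees only the edges
  of vertices in \<open>I\<close> sees only the types of these vertices.\<close>

lemma expectation_states_cong:
  fixes f f' :: "('u \<times> nat \<Rightarrow> bool) \<Rightarrow> real"
  assumes f: "depends_on (UNIV \<times> I) f" and \<tau>: "\<And>i. i \<in> I \<Longrightarrow> \<tau> i = \<tau>' i"
  shows "measure_pmf.expectation (edge_states (G \<tau>)) f = measure_pmf.expectation (edge_states (G \<tau>')) f"
proof -
  have "Pi_pmf (offline H \<times> {1..n} \<inter> UNIV \<times> I) False (G_law \<tau>) =
      Pi_pmf (offline H \<times> {1..n} \<inter> UNIV \<times> I) False (G_law \<tau>')"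
    by (intro Pi_pmf_cong refl) (auto simp: \<tau>)
  then show ?thesis
    unfolding edge_states_inst by (simp only: expectation_Pi_pmf_depends_on[OF finite_edges_inst f])
qed

text \<open>Independence is used at two levels: first over the states for fixed types, then over the
  types. The second level is legitimate because each averaged factor still depends only on the types
  of its own vertices.\<close>

lemma free_output_independent:
  fixes g :: "'b \<Rightarrow> real"
  assumes t: "t < n"
  defines "i \<equiv> \<pi> (Suc t)"
  shows "measure_pmf.expectation (type_profile n D) (\<lambda>\<tau>.
      measure_pmf.expectation (edge_states (G \<tau>)) (\<lambda>st.
        g (\<tau> i) * (free_prob \<tau> t u st * output_prob \<tau> i u st))) =
    measure_pmf.expectation (type_profile n D) (\<lambda>\<tau>.
      measure_pmf.expectation (edge_states (G \<tau>)) (free_prob \<tau> t u)) *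
    measure_pmf.expectation (type_profile n D) (\<lambda>\<tau>.
      g (\<tau> i) * measure_pmf.expectation (edge_states (G \<tau>)) (output_prob \<tau> i u))"
proof -
  define a where "a \<tau> = measure_pmf.expectation (edge_states (G \<tau>)) (free_prob \<tau> t u)" for \<tau>
  define b where "b \<tau> = g (\<tau> i) * measure_pmf.expectation (edge_states (G \<tau>)) (output_prob \<tau> i u)" for \<tau>
  have disj: "\<pi> ` {1..t} \<inter> {i} = {}" using perm_notin[OF t] by (auto simp: i_def)
  have "measure_pmf.expectation (edge_states (G \<tau>)) (\<lambda>st. free_prob \<tau> t u st * output_prob \<tau> i u st) =
      measure_pmf.expectation (edge_states (G \<tau>)) (free_prob \<tau> t u) *
      measure_pmf.expectation (edge_states (G \<tau>)) (output_prob \<tau> i u)" for \<tau>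
    unfolding edge_states_inst
    by (rule expectation_Pi_pmf_mult[OF finite_edges_inst _ depends_on_free_prob _ depends_on_output_prob,
          where B = 1 and C = 1])
       (use disj in \<open>auto simp: free_prob_bounds output_prob_bounds\<close>)
  then have "measure_pmf.expectation (type_profile n D) (\<lambda>\<tau>.
      measure_pmf.expectation (edge_states (G \<tau>)) (\<lambda>st.
        g (\<tau> i) * (free_prob \<tau> t u st * output_prob \<tau> i u st))) =
      measure_pmf.expectation (type_profile n D) (\<lambda>\<tau>. a \<tau> * b \<tau>)"
    by (simp add: a_def b_def mult_ac)
  also have "\<dots> = measure_pmf.expectation (type_profile n D) a * measure_pmf.expectation (type_profile n D) b"
    unfolding type_profile_def
  proof (rule expectation_Pi_pmf_mult[OF _ disj])
    show "depends_on (\<pi> ` {1..t}) a"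
      unfolding depends_on_def
    proof (intro allI impI)
      fix \<tau> \<tau>' :: "nat \<Rightarrow> 'b" assume eq: "\<forall>j\<in>\<pi> ` {1..t}. \<tau> j = \<tau>' j"
      have "steps \<tau> st t = steps \<tau>' st t" for st
        by (rule steps_cong) (use eq in auto)
      then have "free_prob \<tau> t u = free_prob \<tau>' t u"
        by (intro ext) (simp add: free_prob_def)
      then show "a \<tau> = a \<tau>'"
        unfolding a_def using eq by (auto intro!: expectation_states_cong[OF depends_on_free_prob])
    qed
    show "depends_on {i} b"
      unfolding depends_on_def
    proof (intro allI impI)
      fix \<tau> \<tau>' :: "nat \<Rightarrow> 'b" assume eq: "\<forall>j\<in>{i}. \<tau> j = \<tau>' j"
      have "output_prob \<tau> i u = output_prob \<tau>' i u"
        unfolding output_prob_def using eq by simp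
      then show "b \<tau> = b \<tau>'"
        unfolding b_def using eq expectation_states_cong[OF depends_on_output_prob, of i \<tau> \<tau>'] by simp
    qed
    show "\<bar>a \<tau>\<bar> \<le> 1" for \<tau>
      using free_prob_bounds unfolding a_def
      by (auto simp: abs_le_iff intro!: measure_pmf.integral_le_const integrable_edge_states
          order_trans[OF _ integral_nonneg_AE])
    \<comment> \<open>As \<open>g\<close> is arbitrary, the bound comes from the finiteness of the
      support.\<close>
    show "\<bar>b \<tau>\<bar> \<le> (\<Sum>\<tau>\<in>set_pmf (type_profile n D). \<bar>b \<tau>\<bar>)"
      if "\<tau> \<in> set_pmf (Pi_pmf {1..n} undefined D)" for \<tau>
      using that member_le_sum[of \<tau> "set_pmf (type_profile n D)" "\<lambda>\<tau>. \<bar>b \<tau>\<bar>"] finite_type_profile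
      by (auto simp: type_profile_def)
  qed simp
  finally show ?thesis by (simp only: a_def[abs_def] b_def[abs_def])
qed

lemma pr_x_tilde:
  assumes "b \<in> online H"
  shows "pr H (u, b) * x_tilde H x u i b = (\<Sum>es\<in>constr H b. first_active_prob H_law (u, b) es * x i es b)"
  unfolding sum_first_active_prob_eq[OF assms] x_tilde_def by (simp add: sum_distrib_left mult.assoc)

lemma expectation_output_prob:
  assumes \<tau>: "\<forall>i\<in>{1..n}. \<tau> i \<in> online H" and i: "i \<in> {1..n}"
  shows "measure_pmf.expectation (edge_states (G \<tau>)) (output_prob \<tau> i u) =
    pr H (u, \<tau> i) * x_tilde H x u i (\<tau> i) / pmf (D i) (\<tau> i)"
proof -
  have b: "\<tau> i \<in> online H" using \<tau> i by blast
  interpret G: probing_graph "G \<tau>" by (rule probing_graph_inst) (use \<tau> in blast)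
  have "output_prob \<tau> i u st = (\<Sum>es\<in>constr H (\<tau> i).
      of_bool (find st (copy_string i es) = Some (u, i)) * pmf (draw_string H D x i (\<tau> i)) es)" for st
  proof -
    have "(\<lambda>es :: ('u \<times> 'b) list. of_bool (find st (copy_string i es) = Some (u, i)) :: real) =
        indicator ((\<lambda>es. find st (copy_string i es)) -` {Some (u, i)})"
      by (auto simp: indicator_def)
    then have "output_prob \<tau> i u st = measure_pmf.expectation (draw_string H D x i (\<tau> i))
        (\<lambda>es. of_bool (find st (copy_string i es) = Some (u, i)))"
      by (simp add: output_prob_def vertex_probe_def pmf_map)
    also have "\<dots> = (\<Sum>es\<in>constr H (\<tau> i).
      of_bool (find st (copy_string i es) = Some (u, i)) * pmf (draw_string H D x i (\<tau> i)) es)"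
      using set_draw_string[OF i b] by (intro integral_measure_pmf_real H.finite_constr[OF b]) auto
    finally show ?thesis .
  qed
  then have "output_prob \<tau> i u = (\<lambda>st. \<Sum>es\<in>constr H (\<tau> i).
      of_bool (find st (copy_string i es) = Some (u, i)) * pmf (draw_string H D x i (\<tau> i)) es)"
    by (rule ext)
  then have "measure_pmf.expectation (edge_states (G \<tau>)) (output_prob \<tau> i u) =
      (\<Sum>es\<in>constr H (\<tau> i). measure_pmf.expectation (edge_states (G \<tau>))
        (\<lambda>st. of_bool (find st (copy_string i es) = Some (u, i))) * pmf (draw_string H D x i (\<tau> i)) es)"
    by (simp add: Bochner_Integration.integral_sum integrable_edge_states)
  also have "\<dots> = (\<Sum>es\<in>constr H (\<tau> i). first_active_prob H_law (u, \<tau> i) es * (x i es (\<tau> i) / pmf (D i) (\<tau> i)))"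
  proof (intro sum.cong refl arg_cong2[where f = "(*)"])
    fix es assume es: "es \<in> constr H (\<tau> i)"
    then have es': "copy_string i es \<in> constr (G \<tau>) i" by simp
    have i': "i \<in> online (G \<tau>)" using i by simp
    have "measure_pmf.expectation (edge_states (G \<tau>)) (\<lambda>st. of_bool (find st (copy_string i es) = Some (u, i))) =
        first_active_prob (G_law \<tau>) (u, i) (copy_string i es)"
      unfolding edge_states_def
      by (rule expectation_find[OF G.finite_edges G.constrD(1,2)[OF i' es']])
    also have "\<dots> = first_active_prob H_law (u, \<tau> i) es"
      by (rule first_active_prob_copy_string) (rule H.constrD(3)[OF b es])
    finally show "measure_pmf.expectation (edge_states (G \<tau>)) (\<lambda>st. of_bool (find st (copy_string i es) = Some (u, i))) =
        first_active_prob H_law (u, \<tau> i) es" .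
    show "pmf (draw_string H D x i (\<tau> i)) es = x i es (\<tau> i) / pmf (D i) (\<tau> i)"
      using es by (simp add: pmf_draw_string[OF i b])
  qed
  also have "\<dots> = pr H (u, \<tau> i) * x_tilde H x u i (\<tau> i) / pmf (D i) (\<tau> i)"
    unfolding pr_x_tilde[OF b] by (simp add: sum_divide_distrib)
  finally show ?thesis .
qed

text \<open>The factor \<open>1 / pmf (D i) b\<close> of the string law cancels against the
  probability of type \<open>b\<close>, leaving the unconditional LP rate; for \<open>g = 1\<close>
  the sum is \<open>z_marg H x u i\<close>.\<close>

lemma expectation_type_output_prob:
  assumes i: "i \<in> {1..n}"
  shows "measure_pmf.expectation (type_profile n D) (\<lambda>\<tau>.
      g (\<tau> i) * measure_pmf.expectation (edge_states (G \<tau>)) (output_prob \<tau> i u)) =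
    (\<Sum>b\<in>online H. g b * (pr H (u, b) * x_tilde H x u i b))"
proof -
  have "measure_pmf.expectation (type_profile n D) (\<lambda>\<tau>.
      g (\<tau> i) * measure_pmf.expectation (edge_states (G \<tau>)) (output_prob \<tau> i u)) =
    measure_pmf.expectation (type_profile n D) (\<lambda>\<tau>.
      g (\<tau> i) * (pr H (u, \<tau> i) * x_tilde H x u i (\<tau> i) / pmf (D i) (\<tau> i)))"
    by (rule expectation_type_profile_cong) (simp add: expectation_output_prob[OF valid_types i])
  also have "\<dots> = measure_pmf.expectation (D i) (\<lambda>b. g b * (pr H (u, b) * x_tilde H x u i b / pmf (D i) b))"
    by (rule expectation_type[OF i])
  also have "\<dots> = (\<Sum>b\<in>online H. g b * (pr H (u, b) * x_tilde H x u i b / pmf (D i) b) * pmf (D i) b)"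
    using types[OF i] by (intro integral_measure_pmf_real H.finite_online) auto
  also have "\<dots> = (\<Sum>b\<in>online H. g b * (pr H (u, b) * x_tilde H x u i b))"
    by (intro sum.cong refl) (use pos[OF i] in \<open>fastforce simp: field_simps\<close>)
  finally show ?thesis .
qed


definition total_value :: "nat \<Rightarrow> ('u \<Rightarrow> 'b \<Rightarrow> real) \<Rightarrow> real" where
  "total_value t h = measure_pmf.expectation (type_profile n D) (\<lambda>\<tau>.
     measure_pmf.expectation (edge_states (G \<tau>)) (\<lambda>st.
       measure_pmf.expectation (steps \<tau> st t) (matching_value h \<tau>)))"

lemma total_value_0: "total_value 0 h = 0"
  by (simp add: total_value_def matching_value_def)

text \<open>A matching contains at most one edge at \<open>u\<close>, so counting these edges gives
  the indicator that \<open>u\<close> is matched. This closes the recursion in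
  \<open>total_value\<close>.\<close>

lemma expected_free_prob:
  assumes t: "t \<le> n"
  shows "measure_pmf.expectation (type_profile n D) (\<lambda>\<tau>.
      measure_pmf.expectation (edge_states (G \<tau>)) (free_prob \<tau> t u)) =
    1 - total_value t (\<lambda>u' b. of_bool (u' = u))"
proof -
  have free: "free_prob \<tau> t u st =
      1 - measure_pmf.expectation (steps \<tau> st t) (matching_value (\<lambda>u' b. of_bool (u' = u)) \<tau>)"
    if \<tau>: "\<tau> \<in> set_pmf (type_profile n D)" for \<tau> st
  proof -
    have "free_prob \<tau> t u st = measure_pmf.expectation (steps \<tau> st t)
        (\<lambda>M. 1 - matching_value (\<lambda>u' b. of_bool (u' = u)) \<tau> M)"
      unfolding free_prob_def
    proof (intro integral_cong_AE)
      show "AE M in measure_pmf (steps \<tau> st t).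
          of_bool (u \<notin> fst ` M) = 1 - matching_value (\<lambda>u' b. of_bool (u' = u)) \<tau> M"
        unfolding AE_measure_pmf_iff
      proof
        fix M assume M: "M \<in> set_pmf (steps \<tau> st t)"
        note sub = set_steps[OF valid_types[OF \<tau>] t M]
        then have "finite M" using finite_edges_inst by (auto intro: finite_subset)
        then have "matching_value (\<lambda>u' b. of_bool (u' = u)) \<tau> M = card {e \<in> M. fst e = u}"
          by (simp add: matching_value_def Int_def)
        also have "\<dots> = of_bool (u \<in> fst ` M)"
        proof (cases "u \<in> fst ` M")
          case True
          then obtain e where "e \<in> M" "fst e = u" by auto
          then have "{e \<in> M. fst e = u} = {e}" using sub by (auto dest: inj_onD)
          then show ?thesis using True by simp
        next
          case False
          then have "{e \<in> M. fst e = u} = {}" by blast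
          then have "card {e \<in> M. fst e = u} = 0" by (simp only: card.empty)
          then show ?thesis using False by simp
        qed
        finally show "of_bool (u \<notin> fst ` M) = 1 - matching_value (\<lambda>u' b. of_bool (u' = u)) \<tau> M"
          by simp
      qed
    qed auto
    then show ?thesis
      by (simp add: integrable_measure_pmf_finite[OF finite_steps[OF valid_types[OF \<tau>] t]])
  qed
  have "measure_pmf.expectation (type_profile n D) (\<lambda>\<tau>.
      measure_pmf.expectation (edge_states (G \<tau>)) (free_prob \<tau> t u)) =
    measure_pmf.expectation (type_profile n D) (\<lambda>\<tau>. 1 -
      measure_pmf.expectation (edge_states (G \<tau>)) (\<lambda>st.
        measure_pmf.expectation (steps \<tau> st t) (matching_value (\<lambda>u' b. of_bool (u' = u)) \<tau>)))"
  proof (rule expectation_type_profile_cong)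
    fix \<tau> assume "\<tau> \<in> set_pmf (type_profile n D)"
    then have "free_prob \<tau> t u = (\<lambda>st. 1 - measure_pmf.expectation (steps \<tau> st t)
        (matching_value (\<lambda>u' b. of_bool (u' = u)) \<tau>))"
      by (intro ext free)
    then show "measure_pmf.expectation (edge_states (G \<tau>)) (free_prob \<tau> t u) =
      1 - measure_pmf.expectation (edge_states (G \<tau>)) (\<lambda>st.
        measure_pmf.expectation (steps \<tau> st t) (matching_value (\<lambda>u' b. of_bool (u' = u)) \<tau>))"
      by (simp add: integrable_edge_states)
  qed
  then show ?thesis by (simp add: total_value_def integrable_type_profile)
qed

lemma total_value_Suc:
  assumes t: "t < n"
    and q: "\<And>u. u \<in> offline H \<Longrightarrow> 0 \<le> accept u (Suc t) \<and> accept u (Suc t) \<le> 1"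
  shows "total_value (Suc t) h = total_value t h +
    (\<Sum>u\<in>offline H. accept u (Suc t) * ((1 - total_value t (\<lambda>u' b. of_bool (u' = u))) *
      (\<Sum>b\<in>online H. h u b * (pr H (u, b) * x_tilde H x u (\<pi> (Suc t)) b))))"
proof -
  let ?i = "\<pi> (Suc t)"
  have i: "?i \<in> {1..n}" by (rule perm_range) (use t in simp)
  have "total_value (Suc t) h = measure_pmf.expectation (type_profile n D) (\<lambda>\<tau>.
      measure_pmf.expectation (edge_states (G \<tau>)) (\<lambda>st.
        measure_pmf.expectation (steps \<tau> st t) (matching_value h \<tau>) +
        (\<Sum>u\<in>offline H. accept u (Suc t) *
          (h u (\<tau> ?i) * (free_prob \<tau> t u st * output_prob \<tau> ?i u st)))))"
    unfolding total_value_def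
    by (rule expectation_type_profile_cong)
       (simp only: expectation_step[OF valid_types t q] mult.assoc)
  also have "\<dots> = total_value t h + (\<Sum>u\<in>offline H. accept u (Suc t) *
      measure_pmf.expectation (type_profile n D) (\<lambda>\<tau>.
        measure_pmf.expectation (edge_states (G \<tau>)) (\<lambda>st.
          h u (\<tau> ?i) * (free_prob \<tau> t u st * output_prob \<tau> ?i u st))))"
    by (simp add: total_value_def Bochner_Integration.integral_sum integrable_type_profile
        integrable_edge_states del: integral_mult_right_zero)
  finally show ?thesis
    unfolding free_output_independent[OF t] expectation_type_output_prob[OF i]
      expected_free_prob[OF less_imp_le[OF t]] .
qed

lemma z_marg_nonneg:
  assumes "i \<in> {1..n}"
  shows "0 \<le> z_marg H x u i"
  unfolding z_marg_def
  by (intro sum_nonneg)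
     (auto simp: pr_x_tilde first_active_prob_bounds intro!: sum_nonneg mult_nonneg_nonneg x_nonneg[OF assms])

lemma sum_z_marg_le_1:
  assumes "u \<in> offline H"
  shows "(\<Sum>i\<in>{1..n}. z_marg H x u i) \<le> 1"
proof -
  have "(\<Sum>i\<in>{1..n}. z_marg H x u i) =
      (\<Sum>i\<in>{1..n}. \<Sum>b\<in>online H. \<Sum>es\<in>{es \<in> constr H b. (u, b) \<in> set es}.
         pr H (u, b) * none_active H (before es (u, b)) * x i es b)"
    by (simp add: z_marg_def x_tilde_def sum_distrib_left mult.assoc)
  then show ?thesis using feasible assms by (simp add: lp_config_id_feasible_def)
qed

lemma sum_z_marg_perm_le_1:
  assumes "u \<in> offline H" "t \<le> n"
  shows "(\<Sum>j\<in>{1..t}. z_marg H x u (\<pi> j)) \<le> 1"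
proof -
  have "(\<Sum>j\<in>{1..t}. z_marg H x u (\<pi> j)) \<le> (\<Sum>j\<in>{1..n}. z_marg H x u (\<pi> j))"
    \<comment> \<open>All terms are nonnegative, so a prefix in arrival order is bounded by the full
      sum.\<close>
    by (intro sum_mono2 z_marg_nonneg perm_range) (use assms(2) in auto)
  also have "\<dots> = (\<Sum>i\<in>{1..n}. z_marg H x u i)"
    by (rule sum.reindex_bij_betw[OF perm])
  finally show ?thesis using sum_z_marg_le_1[OF assms(1)] by simp
qed

lemma accept_eq: "accept u (Suc t) = 1 / (2 - (\<Sum>j\<in>{1..t}. z_marg H x u (\<pi> j)))"
  by (simp add: accept_prob_def atLeastLessThanSuc_atLeastAtMost)

lemma accept_range:
  assumes "u \<in> offline H" "t \<le> n"
  shows "0 \<le> accept u (Suc t) \<and> accept u (Suc t) \<le> 1"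
  using sum_z_marg_perm_le_1[OF assms] unfolding accept_eq by (simp add: field_simps)

text \<open>The recursion for general weights needs the free probability of every \<open>u\<close>,
  so the indicator weights are settled first. For them all terms with \<open>u' \<noteq> u\<close>
  vanish and the recursion refers only to itself.\<close>

lemma matched_prob:
  assumes "u \<in> offline H" "t \<le> n"
  shows "total_value t (\<lambda>u' b. of_bool (u' = u)) = (\<Sum>j\<in>{1..t}. z_marg H x u (\<pi> j)) / 2"
  using assms(2)
proof (induction t)
  case (Suc t)
  let ?s = "\<Sum>j\<in>{1..t}. z_marg H x u (\<pi> j)"
  let ?h = "\<lambda>u' b :: 'b. of_bool (u' = u) :: real"
  have t: "t < n" using Suc.prems by simp
  have IH: "total_value t ?h = ?s / 2" by (rule Suc.IH) (use t in simp)
  have s: "?s \<le> 1" using sum_z_marg_perm_le_1[OF assms(1)] t by simp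
  have "total_value (Suc t) ?h = total_value t ?h +
    (\<Sum>u'\<in>offline H. accept u' (Suc t) * ((1 - total_value t (\<lambda>v b. of_bool (v = u'))) *
      (\<Sum>b\<in>online H. ?h u' b * (pr H (u', b) * x_tilde H x u' (\<pi> (Suc t)) b))))"
    by (rule total_value_Suc[OF t accept_range]) (use t in auto)
  also have "(\<Sum>u'\<in>offline H. accept u' (Suc t) * ((1 - total_value t (\<lambda>v b. of_bool (v = u'))) *
      (\<Sum>b\<in>online H. ?h u' b * (pr H (u', b) * x_tilde H x u' (\<pi> (Suc t)) b)))) =
    (\<Sum>u'\<in>offline H. if u' = u
      then accept u (Suc t) * ((1 - total_value t ?h) * z_marg H x u (\<pi> (Suc t))) else 0)"
    by (intro sum.cong refl) (auto simp: z_marg_def)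
  also have "total_value t ?h + \<dots> = ?s / 2 + 1 / (2 - ?s) * ((1 - ?s / 2) * z_marg H x u (\<pi> (Suc t)))"
    unfolding IH accept_eq using assms(1) H.finite_offline by simp
  \<comment> \<open>Here \<open>1 - ?s / 2\<close> is half of \<open>2 - ?s\<close>, and
    \<open>?s \<le> 1\<close> keeps the denominator nonzero.\<close>
  also have "1 / (2 - ?s) * ((1 - ?s / 2) * z_marg H x u (\<pi> (Suc t))) = z_marg H x u (\<pi> (Suc t)) / 2"
    using s by (simp add: field_simps)
  finally show ?case by (simp add: add_divide_distrib)
qed (simp add: total_value_0)

lemma total_value_eq:
  assumes "t \<le> n"
  shows "total_value t h = (\<Sum>j\<in>{1..t}. \<Sum>u\<in>offline H. \<Sum>b\<in>online H.
    h u b * (pr H (u, b) * x_tilde H x u (\<pi> j) b)) / 2"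
  using assms
proof (induction t)
  case (Suc t)
  then have t: "t < n" by simp
  have "total_value (Suc t) h = total_value t h +
    (\<Sum>u\<in>offline H. accept u (Suc t) * ((1 - total_value t (\<lambda>u' b. of_bool (u' = u))) *
      (\<Sum>b\<in>online H. h u b * (pr H (u, b) * x_tilde H x u (\<pi> (Suc t)) b))))"
    by (rule total_value_Suc[OF t accept_range]) (use t in auto)
  also have "(\<Sum>u\<in>offline H. accept u (Suc t) * ((1 - total_value t (\<lambda>u' b. of_bool (u' = u))) *
      (\<Sum>b\<in>online H. h u b * (pr H (u, b) * x_tilde H x u (\<pi> (Suc t)) b)))) =
    (\<Sum>u\<in>offline H. (\<Sum>b\<in>online H. h u b * (pr H (u, b) * x_tilde H x u (\<pi> (Suc t)) b)) / 2)"
  proof (rule sum.cong[OF refl])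
    fix u assume u: "u \<in> offline H"
    let ?s = "\<Sum>j\<in>{1..t}. z_marg H x u (\<pi> j)"
    have "?s \<le> 1" using sum_z_marg_perm_le_1[OF u] t by simp
    then have half: "accept u (Suc t) * (1 - total_value t (\<lambda>u' b. of_bool (u' = u))) = 1 / 2"
      using t by (simp add: accept_eq matched_prob[OF u] field_simps)
    show "accept u (Suc t) * ((1 - total_value t (\<lambda>u' b. of_bool (u' = u))) *
        (\<Sum>b\<in>online H. h u b * (pr H (u, b) * x_tilde H x u (\<pi> (Suc t)) b))) =
      (\<Sum>b\<in>online H. h u b * (pr H (u, b) * x_tilde H x u (\<pi> (Suc t)) b)) / 2"
      by (subst mult.assoc[symmetric], subst half) simp
  qed
  finally show ?case
    using Suc by (simp add: add_divide_distrib sum_divide_distrib)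
qed (simp add: total_value_0)

lemma sum_string_val:
  "(\<Sum>b\<in>online H. \<Sum>es\<in>constr H b. string_val H es * x i es b) =
    (\<Sum>u\<in>offline H. \<Sum>b\<in>online H. wt H (u, b) * (pr H (u, b) * x_tilde H x u i b))"
proof -
  have "(\<Sum>es\<in>constr H b. string_val H es * x i es b) =
      (\<Sum>u\<in>offline H. wt H (u, b) * (pr H (u, b) * x_tilde H x u i b))" if b: "b \<in> online H" for b
  proof -
    have "(\<Sum>es\<in>constr H b. string_val H es * x i es b) =
        (\<Sum>es\<in>constr H b. \<Sum>u\<in>offline H. wt H (u, b) * (first_active_prob H_law (u, b) es * x i es b))"
      by (intro sum.cong refl) (simp add: H.string_val_constr[OF b] sum_distrib_right mult.assoc)
    also have "\<dots> = (\<Sum>u\<in>offline H. wt H (u, b) * (pr H (u, b) * x_tilde H x u i b))"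
      unfolding pr_x_tilde[OF b] by (subst sum.swap) (simp add: sum_distrib_left)
    finally show ?thesis .
  qed
  then show ?thesis by (simp add: sum.swap[of _ "offline H"])
qed

theorem expected_weight_aom_id:
  "measure_pmf.expectation (aom_id H n D x \<pi>) (\<lambda>(\<tau>, M). weight (G \<tau>) M) =
     lp_config_id_value H n x / 2"
proof -
  let ?S = "\<lambda>\<tau>. bind_pmf (edge_states (G \<tau>)) (\<lambda>st. map_pmf (\<lambda>M. (\<tau>, M)) (steps \<tau> st n))"
  have "set_pmf (aom_id H n D x \<pi>) \<subseteq> set_pmf (type_profile n D) \<times> Pow (offline H \<times> {1..n})"
    using set_steps[OF valid_types order_refl] by (auto simp: aom_id_def)
  then have fin: "finite (set_pmf (aom_id H n D x \<pi>))"
    by (rule finite_subset) (simp add: finite_type_profile H.finite_offline)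
  have fin': "finite (set_pmf (?S \<tau>))" if "\<tau> \<in> set_pmf (type_profile n D)" for \<tau>
    by (rule finite_subset[OF _ fin]) (use that in \<open>auto simp: aom_id_def\<close>)
  have weight: "weight (G \<tau>) M = matching_value (\<lambda>u b. wt H (u, b)) \<tau> M" for \<tau> M
    unfolding weight_def matching_value_def by (intro sum.cong) auto
  have "measure_pmf.expectation (aom_id H n D x \<pi>) (\<lambda>(\<tau>, M). weight (G \<tau>) M) =
      measure_pmf.expectation (type_profile n D) (\<lambda>\<tau>. measure_pmf.expectation (?S \<tau>) (\<lambda>(\<tau>, M). weight (G \<tau>) M))"
    using fin unfolding aom_id_def by (rule expectation_bind_pmf_finite)
  also have "\<dots> = total_value n (\<lambda>u b. wt H (u, b))"
    unfolding total_value_def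
  proof (rule expectation_type_profile_cong)
    fix \<tau> assume "\<tau> \<in> set_pmf (type_profile n D)"
    from expectation_bind_pmf_finite[OF fin'[OF this]]
    show "measure_pmf.expectation (?S \<tau>) (\<lambda>(\<tau>, M). weight (G \<tau>) M) =
      measure_pmf.expectation (edge_states (G \<tau>)) (\<lambda>st.
        measure_pmf.expectation (steps \<tau> st n) (matching_value (\<lambda>u b. wt H (u, b)) \<tau>))"
      by (simp add: weight)
  qed
  also have "\<dots> = (\<Sum>j\<in>{1..n}. \<Sum>b\<in>online H. \<Sum>es\<in>constr H b. string_val H es * x (\<pi> j) es b) / 2"
    unfolding total_value_eq[OF order_refl] sum_string_val ..
  also have "\<dots> = lp_config_id_value H n x / 2"
    unfolding lp_config_id_value_def
    \<comment> \<open>The arrival order disappears here: each round contributes half of its LP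
      share, wherever it stands in the order.\<close>
    using sum.reindex_bij_betw[OF perm, of "\<lambda>i. \<Sum>b\<in>online H. \<Sum>es\<in>constr H b. string_val H es * x i es b"]
    by simp
  finally show ?thesis .
qed

end

theorem theorem1:
  fixes H :: "('u, 'b) sgraph"
    and n :: nat
    and D :: "nat \<Rightarrow> 'b pmf"
    and x :: "('u, 'b) lp_vars"
    and \<pi> :: "nat \<Rightarrow> nat"
  assumes "stochastic_graph H"
    and "n \<ge> 1"
    and "\<And>i. i \<in> {1..n} \<Longrightarrow> set_pmf (D i) \<subseteq> online H"
    and "\<And>i b. i \<in> {1..n} \<Longrightarrow> b \<in> online H \<Longrightarrow> pmf (D i) b > 0"
    and "bij_betw \<pi> {1..n} {1..n}"
    and "lp_config_id_optimal H n D x"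
  shows "measure_pmf.expectation (aom_id H n D x \<pi>) (\<lambda>(\<tau>, M). weight (inst_graph H n \<tau>) M)
           \<ge> 1 / 2 * OPT_id H n D"
proof -
  interpret aom_id_input H n D x \<pi>
    by unfold_locales (use assms in \<open>auto simp: lp_config_id_optimal_def\<close>)
  have "constr H b \<noteq> {}" if b: "b \<in> online H" for b
  proof
    assume "constr H b = {}"
    \<comment> \<open>Index 1 exists as \<open>n \<ge> 1\<close>; its mass constraint would be an
      empty sum, against positivity.\<close>
    then have "pmf (D 1) b = 0" using sum_x[of 1 b] b \<open>n \<ge> 1\<close> by simp
    then show False using pos[of 1 b] b \<open>n \<ge> 1\<close> by simp
  qed
  then have "OPT_id H n D \<le> lp_config_id_value H n x"
    by (rule OPT_id_le_lp_value) (use assms(6) in \<open>auto simp: lp_config_id_optimal_def\<close>)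
  then show ?thesis by (simp add: expected_weight_aom_id)
qed

end
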